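(* Let $0\le\theta<1$, let $p\in\mathbb{Z}$, and let $\tau=\omega_x+i\omega_y\in\mathbb{C}$ with $\omega_x,\omega_y\in\mathbb{R}$ and $\omega_y>0$. Then the vector space $\mathcal{F}_{\tau,p}$ is a right $A_\theta^\infty$-module (for the right action $\triangleleft$ described in the context) if and only if $$\tau-\tfrac{p\theta}{2}\,i\in\mathbb{Z}+i\mathbb{Z}.$$
   Context: Identify $z=x+iy\in\mathbb{C}$ with $(x,y)\in\mathbb{R}^2$. $C^\infty(\mathbb{C})=C^\infty(\mathbb{R}^2)$ denotes complex-valued smooth functions. $\mathcal{F}_{\tau,p}$ is the set of all $f\in C^\infty(\mathbb{C})$ such that, for all $z=x+iy\in\mathbb{C}$, $$f(z+1)=f(z)\quad\text{and}\quad f(z+\tau)=e^{-\pi ip(\omega_x+2x)}f(z).$$ (Every such $f$ is bounded.) $A_\theta$ is the universal unital $C^*$-algebra generated by two unitaries $U,V$ with $UV=e^{2\pi i\theta}VU$. $A_\theta^\infty\subset A_\theta$ is the subalgebra of series $\sum_{m,n\in\mathbb{Z}}a_{m,n}U^mV^n$ with $\{a_{m,n}\}$ rapidly decreasing, i.e. $\sup_{m,n}(1+m^2+n^2)^k|a_{m,n}|^2<\infty$ for all $k\in\mathbb{N}$. The right action on functions on $\mathbb{R}^2$ is given on generators by $$(f\triangleleft U)(x,y)=e^{2\pi ix}f(x,y-\tfrac12\theta),\qquad (f\triangleleft V)(x,y)=e^{2\pi iy}f(x+\tfrac12\theta,y).$$ Both are invertible operators on $C^\infty(\mathbb{R}^2)$,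 and they satisfy $(f\triangleleft U)\triangleleft V=e^{2\pi i\theta}(f\triangleleft V)\triangleleft U$. For bounded $f$ the action of $a=\sum a_{m,n}U^mV^n\in A_\theta^\infty$ is $f\triangleleft a=\sum_{m,n}a_{m,n}(f\triangleleft U^m)\triangleleft V^n$. "$\mathcal{F}_{\tau,p}$ is a right $A_\theta^\infty$-module" means that $\mathcal{F}_{\tau,p}$ is stable under this right action, i.e. it is a submodule. *)

theory Defs
  imports "HOL-Analysis.Analysis" "HOL-Algebra.Algebraic_Closure_Type"
begin

section \<open>Unital \<open>C\<^sup>*\<close>-algebras and the rotation algebra\<close>

text \<open>Carriers are explicit, so that a universal property can quantify over algebras.\<close>

record 'a cstar = "(complex, 'a) module" +
  star :: "'a \<Rightarrow> 'a"
  anorm :: "'a \<Rightarrow> real"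

text \<open>The zero algebra is excluded (\<open>one_not_zero\<close>).\<close>

locale unital_cstar_algebra =
  ring A + Module.module "ring_of_type_algebra :: complex ring" A
  for A :: "'a cstar" (structure) +
  assumes smult_mult_left:
      "\<lbrakk>x \<in> carrier A; y \<in> carrier A\<rbrakk> \<Longrightarrow> (c \<odot> x) \<otimes> y = c \<odot> (x \<otimes> y)"
    and smult_mult_right:
      "\<lbrakk>x \<in> carrier A; y \<in> carrier A\<rbrakk> \<Longrightarrow> x \<otimes> (c \<odot> y) = c \<odot> (x \<otimes> y)"
    and one_not_zero: "\<one> \<noteq> \<zero>"
    and star_closed: "x \<in> carrier A \<Longrightarrow> star A x \<in> carrier A"
    and star_star: "x \<in> carrier A \<Longrightarrow> star A (star A x) = x"
    and star_add:
      "\<lbrakk>x \<in> carrier A; y \<in> carrier A\<rbrakk> \<Longrightarrow> star A (x \<oplus> y) = star A x \<oplus> star A y"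
    and star_smult: "x \<in> carrier A \<Longrightarrow> star A (c \<odot> x) = cnj c \<odot> star A x"
    and star_mult:
      "\<lbrakk>x \<in> carrier A; y \<in> carrier A\<rbrakk> \<Longrightarrow> star A (x \<otimes> y) = star A y \<otimes> star A x"
    and anorm_nonneg: "x \<in> carrier A \<Longrightarrow> 0 \<le> anorm A x"
    and anorm_eq_0: "x \<in> carrier A \<Longrightarrow> anorm A x = 0 \<longleftrightarrow> x = \<zero>"
    and anorm_triangle:
      "\<lbrakk>x \<in> carrier A; y \<in> carrier A\<rbrakk> \<Longrightarrow> anorm A (x \<oplus> y) \<le> anorm A x + anorm A y"
    and anorm_smult: "x \<in> carrier A \<Longrightarrow> anorm A (c \<odot> x) = cmod c * anorm A x"
    and anorm_mult:
      "\<lbrakk>x \<in> carrier A; y \<in> carrier A\<rbrakk> \<Longrightarrow> anorm A (x \<otimes> y) \<le> anorm A x * anorm A y"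
    and cstar_identity: "x \<in> carrier A \<Longrightarrow> anorm A (star A x \<otimes> x) = (anorm A x)\<^sup>2"
    and anorm_complete:
      "\<lbrakk>\<And>n::nat. s n \<in> carrier A;
        \<And>e. 0 < e \<Longrightarrow> \<exists>N. \<forall>m\<ge>N. \<forall>n\<ge>N. anorm A (s m \<ominus> s n) < e\<rbrakk> \<Longrightarrow>
       \<exists>l\<in>carrier A. (\<lambda>n. anorm A (s n \<ominus> l)) \<longlonglongrightarrow> 0"

definition unitary :: "'a cstar \<Rightarrow> 'a \<Rightarrow> bool" where
  "unitary A u \<longleftrightarrow> u \<in> carrier A \<and>
     star A u \<otimes>\<^bsub>A\<^esub> u = \<one>\<^bsub>A\<^esub> \<and> u \<otimes>\<^bsub>A\<^esub> star A u = \<one>\<^bsub>A\<^esub>"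

text \<open>
  Unital \<open>*\<close>-homomorphisms. The norm bound holds automatically between \<open>C\<^sup>*\<close>-algebras;
  it is listed as part of what a morphism is.
\<close>

definition star_hom :: "'a cstar \<Rightarrow> 'b cstar \<Rightarrow> ('a \<Rightarrow> 'b) set" where
  "star_hom A B = {\<phi> \<in> ring_hom A B. \<forall>x\<in>carrier A.
     (\<forall>c. \<phi> (c \<odot>\<^bsub>A\<^esub> x) = c \<odot>\<^bsub>B\<^esub> \<phi> x) \<and> \<phi> (star A x) = star B (\<phi> x) \<and>
     anorm B (\<phi> x) \<le> anorm A x}"

definition rotation_pair :: "real \<Rightarrow> 'a cstar \<Rightarrow> 'a \<Rightarrow> 'a \<Rightarrow> bool" where
  "rotation_pair \<theta> A u v \<longleftrightarrow> unitary A u \<and> unitary A v \<and>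
     u \<otimes>\<^bsub>A\<^esub> v = exp (2 * of_real pi * \<i> * of_real \<theta>) \<odot>\<^bsub>A\<^esub> (v \<otimes>\<^bsub>A\<^esub> u)"

text \<open>\<open>S\<close> is a norm-closed unital \<open>*\<close>-subalgebra of \<open>A\<close>.\<close>

definition cstar_subalgebra :: "'a set \<Rightarrow> 'a cstar \<Rightarrow> bool" where
  "cstar_subalgebra S A \<longleftrightarrow> S \<subseteq> carrier A \<and> \<one>\<^bsub>A\<^esub> \<in> S \<and>
     (\<forall>x\<in>S. \<forall>y\<in>S. x \<oplus>\<^bsub>A\<^esub> y \<in> S \<and> x \<otimes>\<^bsub>A\<^esub> y \<in> S) \<and>
     (\<forall>x\<in>S. star A x \<in> S \<and> (\<forall>c. c \<odot>\<^bsub>A\<^esub> x \<in> S)) \<and>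
     (\<forall>s. \<forall>l\<in>carrier A. (\<forall>n::nat. s n \<in> S) \<and> (\<lambda>n. anorm A (s n \<ominus>\<^bsub>A\<^esub> l)) \<longlonglongrightarrow> 0 \<longrightarrow> l \<in> S)"

text \<open>
  \<open>A\<close>, with the generators \<open>U\<close> and \<open>V\<close>, is the universal unital \<open>C\<^sup>*\<close>-algebra generated by two
  unitaries subject to the commutation relation. The algebras \<open>B\<close> range over all
  \<open>C\<^sup>*\<close>-algebra structures on subsets of the type \<open>'a\<close>. This is no restriction:
  the \<open>C\<^sup>*\<close>-subalgebra of \<open>B\<close> generated by two elements is separable, so it has at most the
  cardinality of the continuum, and since \<open>A\<close> is not zero, \<open>'a\<close> has at least that cardinality.
  Uniqueness of \<open>\<phi>\<close> on \<open>carrier A\<close> follows from generation.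
\<close>

definition universal_rotation_algebra :: "real \<Rightarrow> 'a cstar \<Rightarrow> 'a \<Rightarrow> 'a \<Rightarrow> bool" where
  "universal_rotation_algebra \<theta> A U V \<longleftrightarrow>
     unital_cstar_algebra A \<and> rotation_pair \<theta> A U V \<and>
     (\<forall>S. cstar_subalgebra S A \<and> U \<in> S \<and> V \<in> S \<longrightarrow> S = carrier A) \<and>
     (\<forall>(B :: 'a cstar) u v. unital_cstar_algebra B \<and> rotation_pair \<theta> B u v \<longrightarrow>
        (\<exists>\<phi>\<in>star_hom A B. \<phi> U = u \<and> \<phi> V = v))"

section \<open>The smooth subalgebra\<close>

definition rapidly_decreasing :: "(int \<times> int \<Rightarrow> complex) \<Rightarrow> bool" where
  "rapidly_decreasing a \<longleftrightarrow> (\<forall>k::nat. bdd_above (range (\<lambda>(m, n).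
     (1 + (real_of_int m)\<^sup>2 + (real_of_int n)\<^sup>2) ^ k * (cmod (a (m, n)))\<^sup>2)))"

text \<open>\<open>x = (\<Sum>m n. a (m, n) U\<^sup>m V\<^sup>n)\<close>, with unconditional convergence in norm.\<close>

definition has_expansion ::
    "'a cstar \<Rightarrow> 'a \<Rightarrow> 'a \<Rightarrow> 'a \<Rightarrow> (int \<times> int \<Rightarrow> complex) \<Rightarrow> bool" where
  "has_expansion A U V x a \<longleftrightarrow>
     ((\<lambda>F. anorm A (finsum A (\<lambda>(m, n). a (m, n) \<odot>\<^bsub>A\<^esub> (U [^]\<^bsub>A\<^esub> m \<otimes>\<^bsub>A\<^esub> V [^]\<^bsub>A\<^esub> n)) F \<ominus>\<^bsub>A\<^esub> x))
        \<longlongrightarrow> 0) (finite_subsets_at_top UNIV)"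

definition smooth_algebra :: "'a cstar \<Rightarrow> 'a \<Rightarrow> 'a \<Rightarrow> 'a set" where
  "smooth_algebra A U V =
     {x \<in> carrier A. \<exists>a. rapidly_decreasing a \<and> has_expansion A U V x a}"

text \<open>In the rotation algebra the coefficients of an element of the smooth subalgebra are unique.\<close>

definition expansion_coeffs :: "'a cstar \<Rightarrow> 'a \<Rightarrow> 'a \<Rightarrow> 'a \<Rightarrow> int \<times> int \<Rightarrow> complex" where
  "expansion_coeffs A U V x = (THE a. rapidly_decreasing a \<and> has_expansion A U V x a)"

section \<open>The right action on functions on the plane\<close>

text \<open>\<open>\<complex>\<close> is identified with \<open>\<real>\<^sup>2\<close> via \<open>z = Complex x y\<close>.\<close>

definition act_U :: "real \<Rightarrow> (complex \<Rightarrow> complex) \<Rightarrow> complex \<Rightarrow> complex" where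
  "act_U \<theta> f z = exp (2 * of_real pi * \<i> * of_real (Re z)) * f (Complex (Re z) (Im z - \<theta> / 2))"

definition act_V :: "real \<Rightarrow> (complex \<Rightarrow> complex) \<Rightarrow> complex \<Rightarrow> complex" where
  "act_V \<theta> f z = exp (2 * of_real pi * \<i> * of_real (Im z)) * f (Complex (Re z + \<theta> / 2) (Im z))"

definition int_funpow :: "('b \<Rightarrow> 'b) \<Rightarrow> int \<Rightarrow> 'b \<Rightarrow> 'b" where
  "int_funpow T k = (if 0 \<le> k then T ^^ nat k else inv_into UNIV T ^^ nat (- k))"

text \<open>The series converges absolutely if \<open>f\<close> is bounded.\<close>

definition nc_action ::
    "real \<Rightarrow> 'a cstar \<Rightarrow> 'a \<Rightarrow> 'a \<Rightarrow> (complex \<Rightarrow> complex) \<Rightarrow> 'a \<Rightarrow> complex \<Rightarrow> complex" where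
  "nc_action \<theta> A U V f x z =
     (\<Sum>\<^sub>\<infinity>(m, n)\<in>UNIV. expansion_coeffs A U V x (m, n) *
        int_funpow (act_V \<theta>) n (int_funpow (act_U \<theta>) m f) z)"

definition right_submodule ::
    "real \<Rightarrow> 'a cstar \<Rightarrow> 'a \<Rightarrow> 'a \<Rightarrow> (complex \<Rightarrow> complex) set \<Rightarrow> bool" where
  "right_submodule \<theta> A U V M \<longleftrightarrow>
     (\<lambda>z. 0) \<in> M \<and> (\<forall>f\<in>M. \<forall>g\<in>M. (\<lambda>z. f z + g z) \<in> M) \<and> (\<forall>c. \<forall>f\<in>M. (\<lambda>z. c * f z) \<in> M) \<and>
     (\<forall>f\<in>M. \<forall>x\<in>smooth_algebra A U V. nc_action \<theta> A U V f x \<in> M)"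

section \<open>Smooth quasi-periodic functions\<close>

text \<open>Here \<open>differentiable\<close> is real differentiability on \<open>\<complex>\<close> as a real vector space.\<close>

primrec C_diff :: "nat \<Rightarrow> (complex \<Rightarrow> complex) \<Rightarrow> bool" where
  "C_diff 0 f \<longleftrightarrow> continuous_on UNIV f"
| "C_diff (Suc k) f \<longleftrightarrow> (\<forall>z. f differentiable (at z)) \<and>
     (\<forall>v. C_diff k (\<lambda>z. frechet_derivative f (at z) v))"

definition smooth_fun :: "(complex \<Rightarrow> complex) \<Rightarrow> bool" where
  "smooth_fun f \<longleftrightarrow> (\<forall>k. C_diff k f)"

definition quasi_periodic :: "complex \<Rightarrow> int \<Rightarrow> (complex \<Rightarrow> complex) set" where
  "quasi_periodic \<tau> p = {f. smooth_fun f \<and> (\<forall>z. f (z + 1) = f z \<and>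
     f (z + \<tau>) = exp (- of_real pi * \<i> * of_int p * of_real (Re \<tau> + 2 * Re z)) * f z)}"

end

(*
  For (m, n) the operator of U^m V^n is multiplication by an exponential followed by a translation
  (lemma act_monomial). Comparing it with the automorphy factor shows that it carries
  quasi-periodic functions to functions whose automorphy factor is multiplied by
  exp (2 pi i (m Re tau + n (Im tau - p theta / 2))). This scalar is 1 for all m, n iff the
  lattice condition holds; a Gaussian times a theta function is a nonzero quasi-periodic function
  that tests it for U and V.

  The coefficients of an element of the smooth algebra are unique because the gauge automorphisms
  U -> s U, V -> t V, which exist by the universal property, separate the monomials. Smoothness of
  the series f <| a follows by induction: its derivatives are combinations of y (f <| a) and series
  of the same kind, with f replaced by a partial derivative, corrected to be quasi-periodic
  again, or a by a polynomially weighted sequence, which is still rapidly decreasing.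
*)

theory Submission
  imports Defs "HOL-Complex_Analysis.Complex_Analysis" "HOL-Real_Asymp.Real_Asymp"
begin

text \<open>The action reads the coefficients of an element through a definite description, so
  nothing is known about it until uniqueness is settled. The algebra is given only by its universal
  property, without a trace or a concrete representation; finite averages over gauge automorphisms,
  which do not increase the norm, replace an integral over the torus. The obstacle to smoothness is
  that the automorphy factor depends on x: the partial derivative of f in x leaves the space and may
  be unbounded. The combination f_x + (2 pi i p / Im tau) y f stays in the space and is bounded.
  Inside the term of index (m, n) the height is y - m theta / 2, so undoing the correction produces
  y times the series itself and a weight m on the coefficients. Thus the series with quasi-periodic
  f and rapidly decreasing coefficients are closed under differentiation up to the factor y, and one
  induction on the order serves all of them.\<close>

section \<open>Units, scalars and homomorphisms in unital C*-algebras\<close>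

lemma (in monoid) Units_nat_pow: "u \<in> Units G \<Longrightarrow> u [^] (n::nat) \<in> Units G"
  by (induction n) auto

lemma (in monoid) Units_int_pow: "u \<in> Units G \<Longrightarrow> u [^] (m::int) \<in> Units G"
  by (simp add: int_pow_def2 Units_nat_pow del: pow_nat)

lemma (in ring) Units_not_zero:
  assumes "\<one> \<noteq> \<zero>" "u \<in> Units R"
  shows "u \<noteq> \<zero>"
  using assms Units_l_inv[of u] by (metis Units_inv_closed r_null)

lemma (in ring) minus_eq_add_uminus_minus:
  assumes "x \<in> carrier R" "y \<in> carrier R" "z \<in> carrier R"
  shows "x \<ominus> y = (x \<ominus> z) \<oplus> \<ominus> (y \<ominus> z)"
proof -
  have "(x \<ominus> z) \<oplus> \<ominus> (y \<ominus> z) = x \<oplus> (\<ominus> y \<oplus> (\<ominus> z \<oplus> z))"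
    using assms by (simp add: a_minus_def minus_add a_ac)
  then show ?thesis
    using assms by (simp add: a_minus_def l_neg)
qed

context unital_cstar_algebra
begin

text \<open>In this locale the unqualified facts of the ring locales refer to the ring of scalars, hence the
  instances for \<open>A\<close>.\<close>

lemma ring_A: "ring A"
  by unfold_locales

lemmas A_simprules = ring.ring_simprules[OF ring_A]

lemma abelian_group_A: "abelian_group A"
  by (rule ring.is_abelian_group[OF ring_A])

lemma abelian_monoid_A: "abelian_monoid A"
  by (rule abelian_group.axioms(1)[OF abelian_group_A])

lemma monoid_A: "monoid A"
  by (rule ring.is_monoid[OF ring_A])

lemma scalar_closed [simp, intro]: "x \<in> carrier A \<Longrightarrow> c \<odot> x \<in> carrier A"
  by (rule smult_closed) (simp_all add: ring_of_type_algebra_def)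

lemma scalar_add_left: "x \<in> carrier A \<Longrightarrow> (c + d) \<odot> x = c \<odot> x \<oplus> d \<odot> x"
  using smult_l_distr[of c d x] by (simp add: ring_of_type_algebra_def)

lemma scalar_add_right:
  "\<lbrakk>x \<in> carrier A; y \<in> carrier A\<rbrakk> \<Longrightarrow> c \<odot> (x \<oplus> y) = c \<odot> x \<oplus> c \<odot> y"
  using smult_r_distr[of c x y] by (simp add: ring_of_type_algebra_def)

lemma scalar_scalar: "x \<in> carrier A \<Longrightarrow> c \<odot> (d \<odot> x) = (c * d) \<odot> x"
  using smult_assoc1[of c d x] by (simp add: ring_of_type_algebra_def)

lemma scalar_one [simp]: "x \<in> carrier A \<Longrightarrow> 1 \<odot> x = x"
  using smult_one[of x] by (simp add: ring_of_type_algebra_def)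

lemma scalar_zero [simp]:
  assumes "x \<in> carrier A"
  shows "0 \<odot> x = \<zero>"
proof -
  have "0 \<odot> x \<oplus> 0 \<odot> x = 0 \<odot> x"
    using scalar_add_left[OF assms, of 0 0] by simp
  then have "\<ominus> (0 \<odot> x) \<oplus> (0 \<odot> x \<oplus> 0 \<odot> x) = \<ominus> (0 \<odot> x) \<oplus> 0 \<odot> x"
    by simp
  then show ?thesis
    using assms by (simp add: A_simprules)
qed

lemma scalar_zero_right [simp]: "c \<odot> \<zero> = \<zero>"
  using scalar_scalar[of \<zero> c 0] by simp

text \<open>Makes norms of differences accessible to \<open>anorm_smult\<close>.\<close>

lemma a_inv_eq_scalar: "x \<in> carrier A \<Longrightarrow> \<ominus> x = (-1) \<odot> x"
  using scalar_add_left[of x 1 "-1"]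
  by (intro abelian_group.minus_equality[OF abelian_group_A]) (simp_all add: A_simprules)

lemma anorm_zero [simp]: "anorm A \<zero> = 0"
  using anorm_eq_0[of \<zero>] by simp

lemma anorm_minus_triangle:
  assumes "x \<in> carrier A" "y \<in> carrier A" "z \<in> carrier A"
  shows "anorm A (x \<ominus> y) \<le> anorm A (x \<ominus> z) + anorm A (y \<ominus> z)"
proof -
  have "x \<ominus> y = (x \<ominus> z) \<oplus> (-1) \<odot> (y \<ominus> z)"
    using assms ring.minus_eq_add_uminus_minus[OF ring_A assms] by (simp add: a_inv_eq_scalar)
  then show ?thesis
    using assms anorm_triangle[of "x \<ominus> z" "(-1) \<odot> (y \<ominus> z)"] by (simp add: anorm_smult)
qed

lemma unitary_imp_Units: "unitary A u \<Longrightarrow> u \<in> Units A"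
  unfolding unitary_def Units_def using star_closed by blast

lemma unitary_scalar:
  assumes "unitary A u" "cmod s = 1"
  shows "unitary A (s \<odot> u)"
proof -
  have u: "u \<in> carrier A" "star A u \<in> carrier A"
    using assms(1) star_closed unfolding unitary_def by auto
  have "cnj s * s = 1"
    using assms(2) complex_norm_square[of s] by (simp add: mult.commute)
  then show ?thesis
    using assms(1) u unfolding unitary_def
    by (simp add: star_smult smult_mult_left smult_mult_right scalar_scalar mult.commute)
qed

text \<open>Both sides of the commutation relation pick up the same factor \<open>s * t\<close>.
  This makes the universal property applicable with A itself as target.\<close>

lemma rotation_pair_scalar:
  assumes "rotation_pair \<theta> A u v" "cmod s = 1" "cmod t = 1"
  shows "rotation_pair \<theta> A (s \<odot> u) (t \<odot> v)"
proof -
  have uv: "u \<in> carrier A" "v \<in> carrier A"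
    and eq: "u \<otimes> v = exp (2 * of_real pi * \<i> * of_real \<theta>) \<odot> (v \<otimes> u)"
    using assms(1) by (auto simp: rotation_pair_def unitary_def)
  have "(s \<odot> u) \<otimes> (t \<odot> v)
      = exp (2 * of_real pi * \<i> * of_real \<theta>) \<odot> ((t \<odot> v) \<otimes> (s \<odot> u))"
    using uv by (simp add: smult_mult_left smult_mult_right scalar_scalar eq mult_ac)
  then show ?thesis
    using assms unitary_scalar by (simp add: rotation_pair_def)
qed

lemma hom_nat_pow_scalar:
  assumes "\<phi> \<in> star_hom A A" "u \<in> carrier A" "\<phi> u = s \<odot> u"
  shows "\<phi> (u [^] (n::nat)) = s ^ n \<odot> (u [^] n)"
proof (induction n)
  case 0
  show ?case
    using assms(1) ring_hom_one[of \<phi> A A] by (simp add: star_hom_def)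
next
  case (Suc n)
  have "\<phi> (u [^] Suc n) = \<phi> (u [^] n) \<otimes> \<phi> u"
    using assms ring_hom_mult[of \<phi> A A] by (simp add: star_hom_def)
  then show ?case
    using Suc assms by (simp add: smult_mult_left smult_mult_right scalar_scalar)
qed

lemma hom_int_pow_scalar:
  assumes \<phi>: "\<phi> \<in> star_hom A A" and u: "u \<in> Units A" and eq: "\<phi> u = s \<odot> u" and s: "s \<noteq> 0"
  shows "\<phi> (u [^] (m::int)) = (s powi m) \<odot> (u [^] m)"
proof (cases "m < 0")
  case False
  then show ?thesis
    using hom_nat_pow_scalar[OF \<phi> monoid.Units_closed[OF monoid_A u] eq, of "nat m"]
    by (simp add: int_pow_def2 power_int_def del: pow_nat)
next
  case True
  define n where "n = nat (- m)"
  define w where "w = u [^] n"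
  have w: "w \<in> Units A" "w \<in> carrier A" "inv w \<in> carrier A"
    unfolding w_def
    by (rule monoid.Units_nat_pow monoid.Units_closed monoid.Units_inv_closed monoid_A u)+
  have rh: "\<phi> \<in> ring_hom A A"
    using \<phi> by (simp add: star_hom_def)
  have \<phi>w: "\<phi> w = s ^ n \<odot> w"
    unfolding w_def by (rule hom_nat_pow_scalar[OF \<phi> monoid.Units_closed[OF monoid_A u] eq])
  have c: "\<phi> (inv w) \<in> carrier A"
    by (rule ring_hom_closed[OF rh w(3)])
  \<comment> \<open>\<open>\<phi> (inv w)\<close> is a left inverse of
    \<open>s ^ n \<odot> w\<close>; multiplying by \<open>inv w\<close> on the right determines
    it.\<close>
  have "\<phi> (inv w) \<otimes> \<phi> w = \<one>"
    using ring_hom_mult[OF rh w(3,2)] ring_hom_one[OF rh] monoid.Units_l_inv[OF monoid_A w(1)] by simp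
  then have "s ^ n \<odot> (\<phi> (inv w) \<otimes> w) = \<one>"
    using c w by (simp add: \<phi>w smult_mult_right)
  then have "s ^ n \<odot> (\<phi> (inv w) \<otimes> w) \<otimes> inv w = inv w"
    using w(3) by simp
  then have "s ^ n \<odot> \<phi> (inv w) = inv w"
    using c w(2,3) monoid.Units_r_inv[OF monoid_A w(1)]
    by (simp add: smult_mult_left monoid.m_assoc[OF monoid_A])
  then have "inverse (s ^ n) \<odot> (s ^ n \<odot> \<phi> (inv w)) = inverse (s ^ n) \<odot> inv w"
    by simp
  then have "\<phi> (inv w) = inverse (s ^ n) \<odot> inv w"
    using c s by (simp add: scalar_scalar)
  then show ?thesis
    using True by (simp add: int_pow_def2 power_int_def n_def w_def power_inverse del: pow_nat)
qed

lemma hom_finsum: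
  assumes "\<phi> \<in> ring_hom A A" "finite F" "\<And>q. q \<in> F \<Longrightarrow> g q \<in> carrier A"
  shows "\<phi> (finsum A g F) = finsum A (\<lambda>q. \<phi> (g q)) F"
  using assms(2,3)
proof (induction F rule: finite_induct)
  case empty
  have "\<phi> \<zero> = \<zero>"
    by (rule ring_hom_zero[OF assms(1) ring_A ring_A])
  then show ?case by simp
next
  case (insert q F)
  then show ?case
    using assms(1) by (simp add: Pi_def ring_hom_closed[OF assms(1)] ring_hom_add[OF assms(1)])
qed

lemma scalar_finsum:
  assumes "finite F" "\<And>q. q \<in> F \<Longrightarrow> g q \<in> carrier A"
  shows "c \<odot> finsum A g F = finsum A (\<lambda>q. c \<odot> g q) F"
  using assms
  by (induction F rule: finite_induct) (simp_all add: Pi_def scalar_add_right)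

lemma scalar_finsum_diff:
  assumes "finite F" "\<And>q. w q \<in> carrier A"
  shows "finsum A (\<lambda>q. a q \<odot> w q) F \<ominus> finsum A (\<lambda>q. b q \<odot> w q) F
    = finsum A (\<lambda>q. (a q - b q) \<odot> w q) F"
proof -
  have "finsum A (\<lambda>q. (a q - b q) \<odot> w q) F
      = finsum A (\<lambda>q. a q \<odot> w q \<oplus> (-1) \<odot> (b q \<odot> w q)) F"
    using assms
    by (intro abelian_monoid.finsum_cong'[OF abelian_monoid_A]) (simp_all add: scalar_scalar flip: scalar_add_left)
  also have "\<dots> = finsum A (\<lambda>q. a q \<odot> w q) F \<oplus> finsum A (\<lambda>q. (-1) \<odot> (b q \<odot> w q)) F"
    using assms by (subst abelian_monoid.finsum_addf[OF abelian_monoid_A]) auto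
  also have "finsum A (\<lambda>q. (-1) \<odot> (b q \<odot> w q)) F = (-1) \<odot> finsum A (\<lambda>q. b q \<odot> w q) F"
    using assms by (simp add: scalar_finsum)
  finally show ?thesis
    using assms by (simp add: a_minus_def a_inv_eq_scalar Pi_def)
qed

end

section \<open>Uniqueness of the coefficients\<close>

text \<open>If the exponents k and l differ, cis (pi / (k - l)) is a root of s^(k - l) = -1. One
  circle variable suffices, and the other is set to 1. Opposite values let an average cancel one of
  two terms and keep the other.\<close>

lemma circle_character_neg_one:
  assumes "(m, n) \<noteq> (m', n')"
  obtains s t :: complex where "cmod s = 1" "cmod t = 1"
    "s powi m * t powi n = - (s powi m' * t powi n')"
proof -
  have neg: "\<exists>s. cmod s = 1 \<and> s powi k = - (s powi l)" if "k \<noteq> l" for k l :: int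
  proof -
    define s where "s = cis (pi / of_int (k - l))"
    have "s powi (k - l) = -1"
      using that by (simp add: s_def cis_power_int)
    moreover have "s \<noteq> 0" "cmod s = 1"
      by (simp_all add: s_def)
    ultimately show ?thesis
      by (intro exI[of _ s]) (simp add: power_int_diff field_simps)
  qed
  show ?thesis
  proof (cases "m = m'")
    case True
    then obtain t where "cmod t = 1" "t powi n = - (t powi n')"
      using assms neg by blast
    then show ?thesis
      using that[of 1 t] by simp
  next
    case False
    then obtain s where "cmod s = 1" "s powi m = - (s powi m')"
      using neg by blast
    then show ?thesis
      using that[of s 1] by simp
  qed
qed

definition monomial :: "'a cstar \<Rightarrow> 'a \<Rightarrow> 'a \<Rightarrow> int \<times> int \<Rightarrow> 'a" where
  "monomial A U V = (\<lambda>(m, n). U [^]\<^bsub>A\<^esub> m \<otimes>\<^bsub>A\<^esub> V [^]\<^bsub>A\<^esub> n)"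

lemma has_expansion_iff:
  "has_expansion A U V x a \<longleftrightarrow>
     ((\<lambda>F. anorm A (finsum A (\<lambda>q. a q \<odot>\<^bsub>A\<^esub> monomial A U V q) F \<ominus>\<^bsub>A\<^esub> x)) \<longlongrightarrow> 0)
       (finite_subsets_at_top UNIV)"
proof -
  have "(\<lambda>(m, n). a (m, n) \<odot>\<^bsub>A\<^esub> (U [^]\<^bsub>A\<^esub> m \<otimes>\<^bsub>A\<^esub> V [^]\<^bsub>A\<^esub> n)) = (\<lambda>q. a q \<odot>\<^bsub>A\<^esub> monomial A U V q)"
    by (auto simp: monomial_def)
  then show ?thesis
    by (simp add: has_expansion_def)
qed

context
  fixes \<theta> :: real and A :: "'a cstar" and U V :: 'a
  assumes univ: "universal_rotation_algebra \<theta> A U V"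
begin

interpretation unital_cstar_algebra A
  using univ by (simp add: universal_rotation_algebra_def)

lemma generators_Units: "U \<in> Units A" "V \<in> Units A"
  using univ unitary_imp_Units by (auto simp: universal_rotation_algebra_def rotation_pair_def)

lemma monomial_Units: "monomial A U V q \<in> Units A"
  using monoid.Units_int_pow[OF monoid_A generators_Units(1)]
    monoid.Units_int_pow[OF monoid_A generators_Units(2)] monoid.Units_m_closed[OF monoid_A]
  by (simp add: monomial_def split: prod.split)

lemma monomial_closed: "monomial A U V q \<in> carrier A"
  by (rule monoid.Units_closed[OF monoid_A monomial_Units])

lemma anorm_monomial_pos: "anorm A (monomial A U V q) > 0"
  using anorm_nonneg[OF monomial_closed] anorm_eq_0[OF monomial_closed]
    ring.Units_not_zero[OF ring_A one_not_zero monomial_Units] by (metis less_eq_real_def)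

lemma gauge_hom:
  assumes "cmod s = 1" "cmod t = 1"
  obtains \<phi> where "\<phi> \<in> star_hom A A"
    "\<And>m n. \<phi> (monomial A U V (m, n)) = (s powi m * t powi n) \<odot>\<^bsub>A\<^esub> monomial A U V (m, n)"
proof -
  have "rotation_pair \<theta> A (s \<odot>\<^bsub>A\<^esub> U) (t \<odot>\<^bsub>A\<^esub> V)"
    using univ rotation_pair_scalar[OF _ assms] by (simp add: universal_rotation_algebra_def)
  moreover have "unital_cstar_algebra B \<and> rotation_pair \<theta> B u v \<longrightarrow>
      (\<exists>\<phi>\<in>star_hom A B. \<phi> U = u \<and> \<phi> V = v)" for B :: "'a cstar" and u v
    using univ unfolding universal_rotation_algebra_def by meson
  ultimately obtain \<phi> where \<phi>: "\<phi> \<in> star_hom A A" "\<phi> U = s \<odot>\<^bsub>A\<^esub> U" "\<phi> V = t \<odot>\<^bsub>A\<^esub> V"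
    using unital_cstar_algebra_axioms by meson
  have nz: "s \<noteq> 0" "t \<noteq> 0"
    using assms by auto
  have cl: "U [^]\<^bsub>A\<^esub> m \<in> carrier A" "V [^]\<^bsub>A\<^esub> m \<in> carrier A" for m :: int
    using monoid.Units_int_pow[OF monoid_A] generators_Units monoid.Units_closed[OF monoid_A]
    by blast+
  have "\<phi> (monomial A U V (m, n)) = (s powi m * t powi n) \<odot>\<^bsub>A\<^esub> monomial A U V (m, n)" for m n
  proof -
    have "\<phi> (U [^]\<^bsub>A\<^esub> m \<otimes>\<^bsub>A\<^esub> V [^]\<^bsub>A\<^esub> n) = \<phi> (U [^]\<^bsub>A\<^esub> m) \<otimes>\<^bsub>A\<^esub> \<phi> (V [^]\<^bsub>A\<^esub> n)"
      using \<phi>(1) cl ring_hom_mult[of \<phi> A A] by (simp add: star_hom_def)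
    then show ?thesis
      using cl
      by (simp add: monomial_def hom_int_pow_scalar[OF \<phi>(1) generators_Units(1) \<phi>(2) nz(1)]
          hom_int_pow_scalar[OF \<phi>(1) generators_Units(2) \<phi>(3) nz(2)]
          smult_mult_left smult_mult_right scalar_scalar mult.commute)
  qed
  then show ?thesis
    using that \<phi>(1) by blast
qed

text \<open>Averaging with a gauge automorphism for which \<open>q\<^sub>0\<close> and \<open>q\<close> have opposite characters removes
  the \<open>q\<close>-term without increasing the norm or changing the \<open>q\<^sub>0\<close>-term.\<close>

lemma anorm_coeff_le:
  assumes "finite F" "q0 \<notin> F"
  shows "anorm A (c q0 \<odot>\<^bsub>A\<^esub> monomial A U V q0)
    \<le> anorm A (finsum A (\<lambda>q. c q \<odot>\<^bsub>A\<^esub> monomial A U V q) (insert q0 F))"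
  using assms
proof (induction F arbitrary: c rule: finite_induct)
  case empty
  then show ?case
    using monomial_closed by simp
next
  case (insert q F)
  define w where "w = monomial A U V"
  have w: "w r \<in> carrier A" for r
    by (simp add: w_def monomial_closed)
  obtain m n m' n' where q: "q = (m, n)" "q0 = (m', n')"
    by (metis surj_pair)
  have "q \<noteq> q0"
    using insert by auto
  then obtain s t where st: "cmod s = 1" "cmod t = 1"
    "s powi m * t powi n = - (s powi m' * t powi n')"
    using circle_character_neg_one[of m n m' n'] q by metis
  obtain \<phi> where \<phi>: "\<phi> \<in> star_hom A A"
    "\<And>m n. \<phi> (w (m, n)) = (s powi m * t powi n) \<odot>\<^bsub>A\<^esub> w (m, n)"
    using gauge_hom[OF st(1,2)] unfolding w_def by metis
  define ch where "ch = (\<lambda>(m, n). s powi m * t powi n)"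
  have ch: "\<phi> (w r) = ch r \<odot>\<^bsub>A\<^esub> w r" for r
    using \<phi>(2) by (cases r) (simp add: ch_def)
  have [simp]: "cmod (ch r) = 1" for r
    using st by (cases r) (simp add: ch_def norm_mult norm_power_int)
  have ch_cnj: "cnj (ch r) * ch r = 1" for r
    using complex_norm_square[of "ch r"] by (simp add: mult.commute)
  have chq: "ch q = - ch q0"
    using st(3) q by (simp add: ch_def)
  \<comment> \<open>The coefficients of (S + conj (ch q0) phi(S)) / 2. The factor conj (ch q0)
    undoes the character at \<open>q0\<close>, so that coefficient survives, and it leaves the sign
    -1 at \<open>q\<close>, so that one vanishes.\<close>
  define c' where "c' r = (1 / 2) * (c r + cnj (ch q0) * (c r * ch r))" for r
  have c': "c' q0 = c q0" "c' q = 0"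
    using ch_cnj[of q0] by (simp_all add: c'_def chq algebra_simps)
  define F' where "F' = insert q0 (insert q F)"
  define S where "S = finsum A (\<lambda>r. c r \<odot>\<^bsub>A\<^esub> w r) F'"
  have fin: "finite F'"
    using insert by (simp add: F'_def)
  have S: "S \<in> carrier A"
    unfolding S_def
    by (rule abelian_monoid.finsum_closed[OF abelian_monoid_A]) (simp add: w)
  have rh: "\<phi> \<in> ring_hom A A"
    using \<phi>(1) by (simp add: star_hom_def)
  have \<phi>S: "\<phi> S \<in> carrier A" "anorm A (\<phi> S) \<le> anorm A S"
    using \<phi>(1) S ring_hom_closed[OF rh] by (auto simp: star_hom_def)
  have "\<phi> S = finsum A (\<lambda>r. \<phi> (c r \<odot>\<^bsub>A\<^esub> w r)) F'"
    unfolding S_def by (rule hom_finsum[OF rh fin]) (simp add: w)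
  also have "(\<lambda>r. \<phi> (c r \<odot>\<^bsub>A\<^esub> w r)) = (\<lambda>r. (c r * ch r) \<odot>\<^bsub>A\<^esub> w r)"
    using \<phi>(1) ch w by (auto simp: star_hom_def scalar_scalar)
  finally have \<phi>S_eq: "\<phi> S = finsum A (\<lambda>r. (c r * ch r) \<odot>\<^bsub>A\<^esub> w r) F'" .
  have "finsum A (\<lambda>r. c' r \<odot>\<^bsub>A\<^esub> w r) F'
      = finsum A (\<lambda>r. (1 / 2) \<odot>\<^bsub>A\<^esub> (c r \<odot>\<^bsub>A\<^esub> w r \<oplus>\<^bsub>A\<^esub> cnj (ch q0) \<odot>\<^bsub>A\<^esub> ((c r * ch r) \<odot>\<^bsub>A\<^esub> w r))) F'"
    unfolding c'_def using w
    by (simp add: scalar_scalar scalar_add_left scalar_add_right distrib_left)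
  also have "\<dots> = (1 / 2) \<odot>\<^bsub>A\<^esub> (S \<oplus>\<^bsub>A\<^esub> cnj (ch q0) \<odot>\<^bsub>A\<^esub> \<phi> S)"
    unfolding \<phi>S_eq unfolding S_def using w fin
    by (simp add: scalar_finsum[symmetric]
        abelian_monoid.finsum_addf[OF abelian_monoid_A] A_simprules)
  finally have eq: "finsum A (\<lambda>r. c' r \<odot>\<^bsub>A\<^esub> w r) F' = (1 / 2) \<odot>\<^bsub>A\<^esub> (S \<oplus>\<^bsub>A\<^esub> cnj (ch q0) \<odot>\<^bsub>A\<^esub> \<phi> S)" .
  \<comment> \<open>An average of two elements of norm at most that of S, since
    \<open>\<phi>\<close> does not increase the norm and \<open>ch q0\<close> has modulus 1.\<close>
  have "anorm A (finsum A (\<lambda>r. c' r \<odot>\<^bsub>A\<^esub> w r) F') \<le> anorm A S"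
    unfolding eq using S \<phi>S anorm_triangle[of S "cnj (ch q0) \<odot>\<^bsub>A\<^esub> \<phi> S"] 
    by (simp add: anorm_smult A_simprules)
  moreover have "finsum A (\<lambda>r. c' r \<odot>\<^bsub>A\<^esub> w r) F' = finsum A (\<lambda>r. c' r \<odot>\<^bsub>A\<^esub> w r) (insert q0 F)"
  proof -
    have "F' = insert q (insert q0 F)" "q \<notin> insert q0 F"
      using insert by (auto simp: F'_def)
    then show ?thesis
      using c' w insert.hyps(1)
      by (simp add: abelian_monoid.finsum_insert[OF abelian_monoid_A] 
          abelian_monoid.finsum_closed[OF abelian_monoid_A] Pi_def
          ring.ring_simprules(8)[OF ring_A])
  qed
  \<comment> \<open>The induction hypothesis for the new coefficients \<open>c'\<close>; this is why
    \<open>c\<close> is arbitrary.\<close>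
  moreover have "anorm A (c' q0 \<odot>\<^bsub>A\<^esub> w q0) \<le> anorm A (finsum A (\<lambda>r. c' r \<odot>\<^bsub>A\<^esub> w r) (insert q0 F))"
    unfolding w_def using insert by simp
  ultimately show ?case
    by (simp add: c' S_def F'_def w_def)
qed

text \<open>The partial sums of both expansions approach x along the same finite sets, so their
  difference becomes arbitrarily small in norm. By \<open>anorm_coeff_le\<close> it dominates the
  term at \<open>q0\<close> as soon as the finite set contains \<open>q0\<close>.\<close>

lemma has_expansion_unique:
  assumes a: "has_expansion A U V x a" and b: "has_expansion A U V x b" and x: "x \<in> carrier A"
  shows "a = b"
proof
  fix q0
  define w where "w = monomial A U V"
  define S where "S c F = finsum A (\<lambda>q. c q \<odot>\<^bsub>A\<^esub> w q) F" for c F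
  have w: "w r \<in> carrier A" for r
    by (simp add: w_def monomial_closed)
  have S: "S c F \<in> carrier A" for c F
    unfolding S_def
    by (rule abelian_monoid.finsum_closed[OF abelian_monoid_A]) (simp add: w)
  have lim: "((\<lambda>F. anorm A (S a F \<ominus>\<^bsub>A\<^esub> x) + anorm A (S b F \<ominus>\<^bsub>A\<^esub> x)) \<longlongrightarrow> 0 + 0)
      (finite_subsets_at_top UNIV)"
    using a b unfolding has_expansion_iff S_def w_def by (rule tendsto_add)
  have "\<forall>\<^sub>F F in finite_subsets_at_top UNIV.
      anorm A ((a q0 - b q0) \<odot>\<^bsub>A\<^esub> w q0) \<le> anorm A (S a F \<ominus>\<^bsub>A\<^esub> x) + anorm A (S b F \<ominus>\<^bsub>A\<^esub> x)"
  proof (rule eventually_finite_subsets_at_top_weakI[THEN eventually_mp])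
    show "\<forall>\<^sub>F F in finite_subsets_at_top UNIV. q0 \<in> F \<and> finite F"
      unfolding eventually_finite_subsets_at_top by (intro exI[of _ "{q0}"]) auto
  next
    fix F :: "(int \<times> int) set"
    show "q0 \<in> F \<and> finite F \<longrightarrow> anorm A ((a q0 - b q0) \<odot>\<^bsub>A\<^esub> w q0)
        \<le> anorm A (S a F \<ominus>\<^bsub>A\<^esub> x) + anorm A (S b F \<ominus>\<^bsub>A\<^esub> x)"
    proof
      assume F: "q0 \<in> F \<and> finite F"
      then have "anorm A ((a q0 - b q0) \<odot>\<^bsub>A\<^esub> w q0) \<le> anorm A (S (\<lambda>q. a q - b q) F)"
        using anorm_coeff_le[of "F - {q0}" q0 "\<lambda>q. a q - b q"]
        by (simp add: S_def w_def insert_absorb)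
      also have "S (\<lambda>q. a q - b q) F = S a F \<ominus>\<^bsub>A\<^esub> S b F"
        unfolding S_def using F w by (simp add: scalar_finsum_diff)
      finally show "anorm A ((a q0 - b q0) \<odot>\<^bsub>A\<^esub> w q0)
          \<le> anorm A (S a F \<ominus>\<^bsub>A\<^esub> x) + anorm A (S b F \<ominus>\<^bsub>A\<^esub> x)"
        using anorm_minus_triangle[OF S S x, of a F b F] by linarith
    qed
  qed
  then have "anorm A ((a q0 - b q0) \<odot>\<^bsub>A\<^esub> w q0) \<le> 0 + 0"
    using lim by (intro tendsto_lowerbound) auto
  then show "a q0 = b q0"
    using anorm_monomial_pos[of q0] w by (simp add: anorm_smult w_def mult_le_0_iff)
qed

lemma expansion_coeffs_eq:
  assumes "rapidly_decreasing a" "has_expansion A U V x a" "x \<in> carrier A"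
  shows "expansion_coeffs A U V x = a"
  unfolding expansion_coeffs_def
  using assms has_expansion_unique by (intro the_equality) blast+

lemma expansion_coeffs_rapid:
  "x \<in> smooth_algebra A U V \<Longrightarrow> rapidly_decreasing (expansion_coeffs A U V x)"
  using expansion_coeffs_eq by (auto simp: smooth_algebra_def)

lemma rapidly_decreasing_delta: "rapidly_decreasing (\<lambda>q. if q = q0 then 1 else 0)"
  unfolding rapidly_decreasing_def
proof
  fix k
  obtain m n where q0: "q0 = (m, n)"
    by fastforce
  show "bdd_above (range (\<lambda>(m, n).
      (1 + (real_of_int m)\<^sup>2 + (real_of_int n)\<^sup>2) ^ k * (cmod (if (m, n) = q0 then 1 else 0))\<^sup>2))"
    by (intro bdd_aboveI[of _ "(1 + (real_of_int m)\<^sup>2 + (real_of_int n)\<^sup>2) ^ k"]) (auto simp: q0)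
qed

lemma has_expansion_monomial:
  "has_expansion A U V (monomial A U V q0) (\<lambda>q. if q = q0 then 1 else 0)"
proof -
  have "finsum A (\<lambda>q. (if q = q0 then 1 else 0) \<odot>\<^bsub>A\<^esub> monomial A U V q) F \<ominus>\<^bsub>A\<^esub> monomial A U V q0 = \<zero>\<^bsub>A\<^esub>"
    if "q0 \<in> F" "finite F" for F
  proof -
    have "finsum A (\<lambda>q. (if q = q0 then 1 else 0) \<odot>\<^bsub>A\<^esub> monomial A U V q) F
        = finsum A (\<lambda>q. if q0 = q then monomial A U V q else \<zero>\<^bsub>A\<^esub>) F"
      using monomial_closed
      by (intro abelian_monoid.finsum_cong'[OF abelian_monoid_A]) auto
    also have "\<dots> = monomial A U V q0"
      using that monomial_closed
      by (intro abelian_monoid.finsum_singleton[OF abelian_monoid_A]) auto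
    finally show ?thesis
      using monomial_closed by (simp add: A_simprules)
  qed
  then have "\<forall>\<^sub>F F in finite_subsets_at_top UNIV. anorm A
      (finsum A (\<lambda>q. (if q = q0 then 1 else 0) \<odot>\<^bsub>A\<^esub> monomial A U V q) F \<ominus>\<^bsub>A\<^esub> monomial A U V q0) = 0"
    unfolding eventually_finite_subsets_at_top by (intro exI[of _ "{q0}"]) auto
  then show ?thesis
    unfolding has_expansion_iff by (rule tendsto_eventually)
qed

lemma monomial_in_smooth_algebra: "monomial A U V q \<in> smooth_algebra A U V"
  unfolding smooth_algebra_def
  using rapidly_decreasing_delta has_expansion_monomial monomial_closed by blast

lemma expansion_coeffs_monomial:
  "expansion_coeffs A U V (monomial A U V q0) = (\<lambda>q. if q = q0 then 1 else 0)"
  by (rule expansion_coeffs_eq[OF rapidly_decreasing_delta has_expansion_monomial monomial_closed])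

end

section \<open>The action of monomials\<close>

text \<open>Negative powers are iterates of \<open>inv_into\<close>. For a family that is additive
  in the exponent, P(-1) is a two-sided inverse of P(1) and hence equals this inverse, so explicit
  formulas for U^m and V^n only need a check of additivity.\<close>

lemma int_funpow_group_action:
  assumes "P 0 = id" and add: "\<And>k l. P (k + l) = P k \<circ> P l"
  shows "int_funpow (P 1) k = P k"
proof -
  have pow: "P l ^^ n = P (int n * l)" for n l
    by (induction n) (simp_all add: assms(1) distrib_right add)
  have "P 1 \<circ> P (-1) = id" "P (-1) \<circ> P 1 = id"
    using add[of 1 "-1"] add[of "-1" 1] assms(1) by simp_all
  then have "inv_into UNIV (P 1) = P (-1)"
    using inv_unique_comp by blast
  then show ?thesis
    by (simp add: int_funpow_def pow)
qed

text \<open>The constant term m n theta / 2 arises because V^n acts after U^m and translates the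
  exponential exp (2 pi i m x) by n theta / 2.\<close>

definition phase :: "real \<Rightarrow> int \<times> int \<Rightarrow> complex \<Rightarrow> complex" where
  "phase \<theta> = (\<lambda>(m, n) z. exp (2 * of_real pi * \<i> *
     of_real (of_int m * Re z + of_int n * Im z + of_int m * of_int n * \<theta> / 2)))"

definition shift :: "real \<Rightarrow> int \<times> int \<Rightarrow> complex" where
  "shift \<theta> = (\<lambda>(m, n). Complex (of_int n * \<theta> / 2) (- of_int m * \<theta> / 2))"

lemma act_U_powers:
  "int_funpow (act_U \<theta>) m f z =
     exp (2 * of_real pi * \<i> * of_real (of_int m * Re z)) * f (Complex (Re z) (Im z - of_int m * \<theta> / 2))"
proof -
  define P where "P m f z = exp (2 * of_real pi * \<i> * of_real (of_int m * Re z)) *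
    f (Complex (Re z) (Im z - of_int m * \<theta> / 2))" for m :: int and f :: "complex \<Rightarrow> complex" and z
  have "P 0 = id"
    by (auto simp: P_def fun_eq_iff)
  moreover have "P (k + l) = P k \<circ> P l" for k l
    by (auto simp: P_def fun_eq_iff algebra_simps add_divide_distrib simp flip: exp_add)
  moreover have "P 1 = act_U \<theta>"
    by (auto simp: P_def act_U_def fun_eq_iff)
  ultimately have "int_funpow (act_U \<theta>) m = P m"
    using int_funpow_group_action[of P m] by simp
  then show ?thesis
    by (simp add: P_def)
qed

lemma act_V_powers:
  "int_funpow (act_V \<theta>) n f z =
     exp (2 * of_real pi * \<i> * of_real (of_int n * Im z)) * f (Complex (Re z + of_int n * \<theta> / 2) (Im z))"
proof -
  define P where "P n f z = exp (2 * of_real pi * \<i> * of_real (of_int n * Im z)) *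
    f (Complex (Re z + of_int n * \<theta> / 2) (Im z))" for n :: int and f :: "complex \<Rightarrow> complex" and z
  have "P 0 = id"
    by (auto simp: P_def fun_eq_iff)
  moreover have "P (k + l) = P k \<circ> P l" for k l
    by (auto simp: P_def fun_eq_iff algebra_simps add_divide_distrib simp flip: exp_add)
  moreover have "P 1 = act_V \<theta>"
    by (auto simp: P_def act_V_def fun_eq_iff)
  ultimately have "int_funpow (act_V \<theta>) n = P n"
    using int_funpow_group_action[of P n] by simp
  then show ?thesis
    by (simp add: P_def)
qed

lemma act_monomial:
  "int_funpow (act_V \<theta>) n (int_funpow (act_U \<theta>) m f) z = phase \<theta> (m, n) z * f (z + shift \<theta> (m, n))"
proof -
  have "Complex (Re z + of_int n * \<theta> / 2) (Im z - of_int m * \<theta> / 2) = z + shift \<theta> (m, n)"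
    by (simp add: shift_def complex_eq_iff)
  then show ?thesis
    by (simp add: act_U_powers act_V_powers phase_def algebra_simps flip: exp_add)
qed

text \<open>Indexed by a family of coefficients and not by an element of the algebra:
  differentiation replaces the family by weighted ones, and no elements with these coefficients have
  to be constructed.\<close>

definition twisted_series ::
    "real \<Rightarrow> (complex \<Rightarrow> complex) \<Rightarrow> (int \<times> int \<Rightarrow> complex) \<Rightarrow> complex \<Rightarrow> complex" where
  "twisted_series \<theta> f a z = (\<Sum>\<^sub>\<infinity>q. a q * (phase \<theta> q z * f (z + shift \<theta> q)))"

lemma nc_action_eq_twisted_series:
  "nc_action \<theta> A U V f x = twisted_series \<theta> f (expansion_coeffs A U V x)"
  unfolding nc_action_def twisted_series_def
  by (intro ext infsum_cong) (auto simp: act_monomial)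

lemma norm_phase [simp]: "cmod (phase \<theta> q z) = 1"
proof -
  have "phase \<theta> q z = cis (2 * pi * (of_int (fst q) * Re z + of_int (snd q) * Im z
      + of_int (fst q) * of_int (snd q) * \<theta> / 2))"
    by (simp add: phase_def cis_conv_exp mult_ac split: prod.split)
  then show ?thesis
    by simp
qed

section \<open>Rapidly decreasing families\<close>

lemma summable_on_inverse_square_int: "(\<lambda>m::int. 1 / (1 + (real_of_int m)\<^sup>2)) summable_on UNIV"
proof -
  have nat: "(\<lambda>n::nat. 1 / (1 + (real n)\<^sup>2)) summable_on UNIV"
  proof (rule norm_summable_imp_summable_on, rule summable_comparison_test)
    show "summable (\<lambda>n. 2 * inverse ((real (Suc n))\<^sup>2))"
      using inverse_squares_sums
      by (intro summable_mult) (simp add: sums_iff inverse_eq_divide add.commute)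
    have "1 / (1 + (real n)\<^sup>2) \<le> 2 * inverse ((real (Suc n))\<^sup>2)" for n
    proof -
      have "(1 + real n)\<^sup>2 \<le> 2 * (1 + (real n)\<^sup>2)"
        using zero_le_power2[of "real n - 1"] by (simp add: power2_eq_square algebra_simps)
      then show ?thesis
        by (simp add: field_simps add_pos_nonneg)
    qed
    then show "\<exists>N. \<forall>n\<ge>N. norm (norm (1 / (1 + (real n)\<^sup>2))) \<le> 2 * inverse ((real (Suc n))\<^sup>2)"
      by (auto simp: add_nonneg_nonneg)
  qed
  have "(\<lambda>m::int. 1 / (1 + (real_of_int m)\<^sup>2)) summable_on (range int)"
    using nat by (subst summable_on_reindex) (auto simp: o_def)
  moreover have "(\<lambda>m::int. 1 / (1 + (real_of_int m)\<^sup>2)) summable_on (range (\<lambda>n. - int n))"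
    using nat by (subst summable_on_reindex) (auto simp: o_def inj_def)
  ultimately have "(\<lambda>m::int. 1 / (1 + (real_of_int m)\<^sup>2)) summable_on (range int \<union> range (\<lambda>n. - int n))"
    by (rule summable_on_union)
  moreover have "k \<in> range int \<union> range (\<lambda>n. - int n)" for k
    by (cases k rule: int_cases2) auto
  then have "range int \<union> range (\<lambda>n. - int n) = UNIV"
    by blast
  ultimately show ?thesis
    by simp
qed

lemma rapidly_decreasing_iff:
  "rapidly_decreasing a \<longleftrightarrow>
     (\<forall>k. \<exists>C. \<forall>m n. (1 + (real_of_int m)\<^sup>2 + (real_of_int n)\<^sup>2) ^ k * (cmod (a (m, n)))\<^sup>2 \<le> C)"
  by (simp add: rapidly_decreasing_def bdd_above_def)

text \<open>With N = 1 + m^2 + n^2, the bound for the exponent 4 gives |a| <= sqrt C / N^2, and N^2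
  >= (1 + m^2)(1 + n^2). The double sum is thus dominated by a product of two convergent single
  sums.\<close>

lemma rapidly_decreasing_summable:
  assumes "rapidly_decreasing a"
  shows "(\<lambda>q. cmod (a q)) summable_on UNIV"
proof -
  obtain C where C: "(1 + (real_of_int m)\<^sup>2 + (real_of_int n)\<^sup>2) ^ 4 * (cmod (a (m, n)))\<^sup>2 \<le> C" for m n
    using assms unfolding rapidly_decreasing_iff by blast
  have "C \<ge> 0"
    using order_trans[OF zero_le_power2[of "cmod (a (0, 0))"], of C] C[of 0 0] by simp
  have le: "cmod (a (m, n)) \<le> sqrt C * (1 / (1 + (real_of_int m)\<^sup>2) * (1 / (1 + (real_of_int n)\<^sup>2)))" for m n
  proof -
    define M N where "M = (real_of_int m)\<^sup>2" and "N = (real_of_int n)\<^sup>2"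
    have MN: "M \<ge> 0" "N \<ge> 0"
      by (simp_all add: M_def N_def)
    have "(1 + M) * (1 + N) \<le> (1 + M + N)\<^sup>2"
      using MN by (simp add: power2_eq_square algebra_simps add_nonneg_nonneg)
    then have "((1 + M) * (1 + N))\<^sup>2 \<le> ((1 + M + N)\<^sup>2)\<^sup>2"
      using MN by (intro power_mono) auto
    then have "((1 + M) * (1 + N))\<^sup>2 * (cmod (a (m, n)))\<^sup>2 \<le> (1 + M + N) ^ 4 * (cmod (a (m, n)))\<^sup>2"
      by (intro mult_right_mono) (simp_all flip: power_mult)
    also have "\<dots> \<le> C"
      using C by (simp add: M_def N_def)
    finally have "((1 + M) * (1 + N) * cmod (a (m, n)))\<^sup>2 \<le> C"
      by (simp add: power_mult_distrib)
    then have "(1 + M) * (1 + N) * cmod (a (m, n)) \<le> sqrt C"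
      by (rule real_le_rsqrt)
    moreover have "(1 + M) * (1 + N) > 0"
      using MN by (intro mult_pos_pos) auto
    ultimately have "cmod (a (m, n)) \<le> sqrt C / ((1 + M) * (1 + N))"
      by (simp add: pos_le_divide_eq mult.commute)
    then show ?thesis
      by (simp add: M_def N_def)
  qed
  have "(\<lambda>(m::int, n::int). 1 / (1 + (real_of_int m)\<^sup>2) * (1 / (1 + (real_of_int n)\<^sup>2)))
      summable_on (UNIV \<times> UNIV)"
  proof (rule summable_on_SigmaI)
    show "((\<lambda>n::int. case (m, n) of (m, n) \<Rightarrow> 1 / (1 + (real_of_int m)\<^sup>2) * (1 / (1 + (real_of_int n)\<^sup>2)))
        has_sum 1 / (1 + (real_of_int m)\<^sup>2) * (\<Sum>\<^sub>\<infinity>n::int. 1 / (1 + (real_of_int n)\<^sup>2))) UNIV" for m :: int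
      unfolding prod.case
      by (intro has_sum_cmult_right has_sum_infsum summable_on_inverse_square_int)
    show "(\<lambda>m::int. 1 / (1 + (real_of_int m)\<^sup>2) * (\<Sum>\<^sub>\<infinity>n::int. 1 / (1 + (real_of_int n)\<^sup>2)))
        summable_on UNIV"
      by (intro summable_on_cmult_left summable_on_inverse_square_int)
  qed auto
  then have "(\<lambda>q::int \<times> int. sqrt C * (1 / (1 + (real_of_int (fst q))\<^sup>2) * (1 / (1 + (real_of_int (snd q))\<^sup>2))))
      summable_on UNIV"
    by (intro summable_on_cmult_right) (simp add: case_prod_unfold)
  then show ?thesis
    by (rule summable_on_comparison_test) (use le in auto)
qed

text \<open>The weight costs one power of 1 + m^2 + n^2, so the bound for \<open>k\<close> comes
  from that for \<open>Suc k\<close>.\<close>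

lemma rapidly_decreasing_weight:
  assumes a: "rapidly_decreasing a"
    and w: "\<And>m n. (cmod (w (m, n)))\<^sup>2 \<le> B * (1 + (real_of_int m)\<^sup>2 + (real_of_int n)\<^sup>2)"
  shows "rapidly_decreasing (\<lambda>q. w q * a q)"
  unfolding rapidly_decreasing_iff
proof
  fix k
  obtain C where C: "(1 + (real_of_int m)\<^sup>2 + (real_of_int n)\<^sup>2) ^ Suc k * (cmod (a (m, n)))\<^sup>2 \<le> C" for m n
    using a unfolding rapidly_decreasing_iff by blast
  have "B \<ge> 0"
    using order_trans[OF zero_le_power2 w[of 0 0]] by simp
  have "(1 + (real_of_int m)\<^sup>2 + (real_of_int n)\<^sup>2) ^ k * (cmod (w (m, n) * a (m, n)))\<^sup>2 \<le> B * C" for m n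
  proof -
    define N where "N = 1 + (real_of_int m)\<^sup>2 + (real_of_int n)\<^sup>2"
    have N: "N \<ge> 0"
      by (simp add: N_def)
    have "N ^ k * (cmod (w (m, n) * a (m, n)))\<^sup>2 = N ^ k * (cmod (a (m, n)))\<^sup>2 * (cmod (w (m, n)))\<^sup>2"
      by (simp add: norm_mult power_mult_distrib)
    also have "\<dots> \<le> N ^ k * (cmod (a (m, n)))\<^sup>2 * (B * N)"
      using w[of m n] N by (intro mult_left_mono) (simp_all add: N_def)
    also have "\<dots> = B * (N ^ Suc k * (cmod (a (m, n)))\<^sup>2)"
      by simp
    also have "\<dots> \<le> B * C"
      using C[of m n] \<open>B \<ge> 0\<close> by (intro mult_left_mono) (simp_all add: N_def)
    finally show ?thesis
      by (simp add: N_def)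
  qed
  then show "\<exists>C. \<forall>m n. (1 + (real_of_int m)\<^sup>2 + (real_of_int n)\<^sup>2) ^ k * (cmod (w (m, n) * a (m, n)))\<^sup>2 \<le> C"
    by blast
qed

section \<open>Termwise differentiation and C^k functions\<close>

text \<open>An enumeration of the countably infinite index set reduces this to
  \<open>has_derivative_series\<close>; absolute convergence makes the order irrelevant. Domination
  is asked only on balls, because the derivatives in the application carry the unbounded factor
  y.\<close>

lemma has_derivative_infsum:
  fixes g :: "'i::countable \<Rightarrow> 'a::real_normed_vector \<Rightarrow> 'b::banach"
  assumes inf: "infinite (UNIV :: 'i set)"
    and der: "\<And>q z. (g q has_derivative g' q z) (at z)"
    and dom: "\<And>R. \<exists>b. b summable_on UNIV \<and>
      (\<forall>q z. norm z < R \<longrightarrow> norm (g q z) \<le> b q \<and> (\<forall>h. norm (g' q z h) \<le> b q * norm h))"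
  shows "((\<lambda>z. \<Sum>\<^sub>\<infinity>q. g q z) has_derivative (\<lambda>h. \<Sum>\<^sub>\<infinity>q. g' q z h)) (at z)"
proof -
  define S where "S = ball (0::'a) (norm z + 1)"
  obtain b where b: "b summable_on UNIV"
    "\<And>q z. z \<in> S \<Longrightarrow> norm (g q z) \<le> b q" "\<And>q z h. z \<in> S \<Longrightarrow> norm (g' q z h) \<le> b q * norm h"
    using dom[of "norm z + 1"] by (auto simp: S_def)
  define e :: "nat \<Rightarrow> 'i" where "e = from_nat_into UNIV"
  have e: "bij_betw e UNIV UNIV"
    unfolding e_def by (rule bij_betw_from_nat_into) (use inf in auto)
  have z: "z \<in> S"
    by (simp add: S_def)
  have b_nonneg: "b q \<ge> 0" for q
    using b(2)[OF z, of q] norm_ge_zero order_trans by blast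
  have b_sum: "summable (\<lambda>n. b (e n))"
    using b(1) summable_on_reindex_bij_betw[OF e, of b] by (intro summable_on_imp_summable) simp
  have sums: "(\<lambda>n. f (e n)) sums (\<Sum>\<^sub>\<infinity>q. f q)" if "\<And>q. norm (f q) \<le> c * b q" for f :: "'i \<Rightarrow> 'b" and c
  proof -
    have "f summable_on UNIV"
      by (rule Infinite_Sum.abs_summable_summable,
        rule Infinite_Sum.abs_summable_on_comparison_test'[where g = "\<lambda>q. c * b q"])
        (use that b(1) in \<open>auto intro: summable_on_cmult_right\<close>)
    then have "(f has_sum (\<Sum>\<^sub>\<infinity>q. f q)) UNIV"
      by (rule has_sum_infsum)
    then have "((\<lambda>n. f (e n)) has_sum (\<Sum>\<^sub>\<infinity>q. f q)) UNIV"
      using has_sum_reindex_bij_betw[OF e, of f] by simp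
    then show ?thesis
      by (rule has_sum_imp_sums)
  qed
  have "\<exists>G. \<forall>x\<in>S. (\<lambda>n. g (e n) x) sums G x \<and> (G has_derivative (\<lambda>h. \<Sum>\<^sub>\<infinity>q. g' q x h)) (at x within S)"
  proof (rule has_derivative_series[where f' = "\<lambda>n. g' (e n)"])
    show "convex S"
      by (simp add: S_def)
    show "(g (e n) has_derivative g' (e n) x) (at x within S)" for n x
      using der has_derivative_at_withinI by blast
    show "z \<in> S" "(\<lambda>n. g (e n) z) sums (\<Sum>\<^sub>\<infinity>q. g q z)"
      using z sums[of "\<lambda>q. g q z" 1] b(2) by auto
    fix \<epsilon> :: real
    assume "\<epsilon> > 0"
    \<comment> \<open>The tails of \<open>b\<close> bound the error of the partial sums of
      derivatives uniformly on \<open>S\<close>.\<close>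
    then have "\<forall>\<^sub>F n in sequentially. (\<Sum>i. b (e (i + n))) < \<epsilon>"
      using suminf_exist_split2[OF b_sum] order_tendstoD(2) by blast
    then show "\<forall>\<^sub>F n in sequentially. \<forall>x\<in>S. \<forall>h.
        norm ((\<Sum>i<n. g' (e i) x h) - (\<Sum>\<^sub>\<infinity>q. g' q x h)) \<le> \<epsilon> * norm h"
    proof eventually_elim
      case (elim n)
      show ?case
      proof (intro ballI allI)
        fix x h
        assume x: "x \<in> S"
        have s: "(\<lambda>i. g' (e i) x h) sums (\<Sum>\<^sub>\<infinity>q. g' q x h)"
          using sums[of "\<lambda>q. g' q x h" "norm h"] b(3)[OF x] by (simp add: mult.commute)
        have sb: "summable (\<lambda>i. b (e (i + n)) * norm h)"
          using b_sum by (intro summable_mult2) (simp add: summable_iff_shift[of "\<lambda>i. b (e i)"])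
        have "(\<Sum>\<^sub>\<infinity>q. g' q x h) - (\<Sum>i<n. g' (e i) x h) = (\<Sum>i. g' (e (i + n)) x h)"
          using suminf_minus_initial_segment[OF sums_summable[OF s], of n] sums_unique[OF s] by simp
        then have "norm ((\<Sum>i<n. g' (e i) x h) - (\<Sum>\<^sub>\<infinity>q. g' q x h)) = norm (\<Sum>i. g' (e (i + n)) x h)"
          by (metis norm_minus_commute)
        also have "\<dots> \<le> (\<Sum>i. b (e (i + n)) * norm h)"
          by (rule norm_suminf_le[OF _ sb]) (use b(3)[OF x] in auto)
        also have "\<dots> = (\<Sum>i. b (e (i + n))) * norm h"
          using b_sum
          by (intro suminf_mult2[symmetric]) (simp add: summable_iff_shift[of "\<lambda>i. b (e i)"])
        also have "\<dots> \<le> \<epsilon> * norm h"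
          using elim by (intro mult_right_mono) auto
        finally show "norm ((\<Sum>i<n. g' (e i) x h) - (\<Sum>\<^sub>\<infinity>q. g' q x h)) \<le> \<epsilon> * norm h" .
      qed
    qed
  qed
  then obtain G where G: "\<And>x. x \<in> S \<Longrightarrow> (\<lambda>n. g (e n) x) sums G x"
    "\<And>x. x \<in> S \<Longrightarrow> (G has_derivative (\<lambda>h. \<Sum>\<^sub>\<infinity>q. g' q x h)) (at x within S)"
    by blast
  have "G x = (\<Sum>\<^sub>\<infinity>q. g q x)" if "x \<in> S" for x
    using G(1)[OF that] sums[of "\<lambda>q. g q x" 1] b(2)[OF that] sums_unique2 by fastforce
  then have "((\<lambda>z. \<Sum>\<^sub>\<infinity>q. g q z) has_derivative (\<lambda>h. \<Sum>\<^sub>\<infinity>q. g' q z h)) (at z within S)"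
    by (intro has_derivative_transform[OF z _ G(2)[OF z]]) simp
  then show ?thesis
    using at_within_open[OF z] by (simp add: S_def)
qed

lemma C_diff_imp_continuous: "C_diff k f \<Longrightarrow> continuous_on UNIV f"
  by (cases k) (auto intro!: differentiable_imp_continuous_on simp: differentiable_on_def)

text \<open>Uniqueness of the derivative lets any known derivative stand for
  \<open>frechet_derivative\<close>; the inductions on the order rest on this form.\<close>

lemma C_diff_Suc_iff:
  assumes "\<And>z. (f has_derivative D z) (at z)"
  shows "C_diff (Suc k) f \<longleftrightarrow> (\<forall>v. C_diff k (\<lambda>z. D z v))"
  using assms frechet_derivative_at[OF assms] by (auto simp: differentiable_def)

lemma C_diff_SucE:
  assumes "C_diff (Suc k) f"
  obtains D where "\<And>z. (f has_derivative D z) (at z)" "\<And>v. C_diff k (\<lambda>z. D z v)"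
proof
  show "(f has_derivative frechet_derivative f (at z)) (at z)" for z
    using assms by (simp flip: frechet_derivative_works)
  show "C_diff k (\<lambda>z. frechet_derivative f (at z) v)" for v
    using assms by simp
qed

text \<open>Needed for products: the derivative of f g contains f and g themselves, which are given
  with order k + 1 while the induction hypothesis asks for order k.\<close>

lemma C_diff_pred: "C_diff (Suc k) f \<Longrightarrow> C_diff k f"
proof (induction k arbitrary: f)
  case 0
  then show ?case
    using C_diff_imp_continuous[of "Suc 0" f] by simp
next
  case (Suc k)
  then show ?case
    using C_diff_SucE[OF Suc.prems] C_diff_Suc_iff by metis
qed

lemma C_diff_add: "C_diff k f \<Longrightarrow> C_diff k g \<Longrightarrow> C_diff k (\<lambda>z. f z + g z)"
proof (induction k arbitrary: f g)
  case 0
  then show ?case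
    by (simp add: continuous_on_add)
next
  case (Suc k)
  obtain F G where FG: "\<And>z. (f has_derivative F z) (at z)" "\<And>v. C_diff k (\<lambda>z. F z v)"
    "\<And>z. (g has_derivative G z) (at z)" "\<And>v. C_diff k (\<lambda>z. G z v)"
    using Suc.prems by (metis C_diff_SucE)
  have "((\<lambda>z. f z + g z) has_derivative (\<lambda>v. F z v + G z v)) (at z)" for z
    using FG by (intro has_derivative_add)
  from C_diff_Suc_iff[OF this] show ?case
    using Suc.IH FG by blast
qed

lemma C_diff_mult: "C_diff k f \<Longrightarrow> C_diff k g \<Longrightarrow> C_diff k (\<lambda>z. f z * g z)"
proof (induction k arbitrary: f g)
  case 0
  then show ?case
    by (simp add: continuous_on_mult)
next
  case (Suc k)
  obtain F G where FG: "\<And>z. (f has_derivative F z) (at z)" "\<And>v. C_diff k (\<lambda>z. F z v)"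
    "\<And>z. (g has_derivative G z) (at z)" "\<And>v. C_diff k (\<lambda>z. G z v)"
    using Suc.prems by (metis C_diff_SucE)
  have der: "((\<lambda>z. f z * g z) has_derivative (\<lambda>v. f z * G z v + F z v * g z)) (at z)" for z
    using FG by (intro has_derivative_mult)
  have "C_diff k (\<lambda>z. f z * G z v + F z v * g z)" for v
    by (intro C_diff_add Suc.IH FG C_diff_pred[OF Suc.prems(1)] C_diff_pred[OF Suc.prems(2)])
  then show ?case
    unfolding C_diff_Suc_iff[OF der] by blast
qed

text \<open>The derivative in direction v is \<open>c * L v\<close> times deriv h (L z), again of
  the same form, so the induction closes once \<open>h\<close> and \<open>c\<close> vary.
  \<open>L\<close> need only be real-linear, which covers functions of Im z such as the Gaussian
  below.\<close>

lemma C_diff_holomorphic_comp: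
  assumes "bounded_linear L"
  shows "h holomorphic_on UNIV \<Longrightarrow> C_diff k (\<lambda>z. c * h (L z))"
proof (induction k arbitrary: h c)
  case 0
  then show ?case
    using holomorphic_on_imp_continuous_on[OF 0] linear_continuous_on[OF assms]
    by (auto intro!: continuous_on_mult continuous_on_compose2[of UNIV h UNIV L])
next
  case (Suc k)
  have "((\<lambda>z. c * h (L z)) has_derivative (\<lambda>v. c * (deriv h (L z) * L v))) (at z)" for z
  proof -
    have "(h has_derivative (\<lambda>v. deriv h (L z) * v)) (at (L z))"
      using holomorphic_derivI[OF Suc.prems, of "L z"] by (simp add: has_field_derivative_def)
    then have "((\<lambda>z. h (L z)) has_derivative (\<lambda>v. deriv h (L z) * L v)) (at z)"
      using has_derivative_compose[OF bounded_linear.has_derivative[OF assms has_derivative_ident]] by fastforce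
    then show ?thesis
      by (intro has_derivative_mult_right)
  qed
  from C_diff_Suc_iff[OF this] show ?case
    using Suc.IH[of "deriv h" "c * L v" for v] holomorphic_deriv[OF Suc.prems open_UNIV]
    by (simp add: mult_ac)
qed

lemma C_diff_const: "C_diff k (\<lambda>z. c)"
  using C_diff_holomorphic_comp[of "\<lambda>z. z" "\<lambda>z. 1" k c] by (simp add: bounded_linear_ident)

lemma C_diff_Im: "C_diff k (\<lambda>z. of_real (Im z))"
  using C_diff_holomorphic_comp[of "\<lambda>z. of_real (Im z)" "\<lambda>z. z" k 1]
  by (simp add: bounded_linear_compose[OF bounded_linear_of_real bounded_linear_Im])

lemma has_derivative_exp_compose:
  fixes g :: "'a::real_normed_vector \<Rightarrow> complex"
  assumes "(g has_derivative g') (at z)"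
  shows "((\<lambda>z. exp (g z)) has_derivative (\<lambda>v. exp (g z) * g' v)) (at z)"
  using has_derivative_compose[OF assms DERIV_exp[unfolded has_field_derivative_def]] by simp

section \<open>Quasi-periodic functions and their derivatives\<close>

definition automorphy :: "complex \<Rightarrow> int \<Rightarrow> complex \<Rightarrow> complex" where
  "automorphy \<tau> p z = exp (- of_real pi * \<i> * of_int p * of_real (Re \<tau> + 2 * Re z))"

lemma norm_automorphy [simp]: "cmod (automorphy \<tau> p z) = 1"
proof -
  have "automorphy \<tau> p z = cis (- pi * of_int p * (Re \<tau> + 2 * Re z))"
    by (simp add: automorphy_def cis_conv_exp mult_ac)
  then show ?thesis
    by simp
qed

lemma automorphy_has_derivative:
  "(automorphy \<tau> p has_derivative
     (\<lambda>v. automorphy \<tau> p z * (- 2 * of_real pi * \<i> * of_int p * of_real (Re v)))) (at z)"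
  unfolding automorphy_def
  by (rule has_derivative_exp_compose) (auto intro!: derivative_eq_intros)

lemma quasi_periodic_iff:
  "f \<in> quasi_periodic \<tau> p \<longleftrightarrow>
     smooth_fun f \<and> (\<forall>z. f (z + 1) = f z) \<and> (\<forall>z. f (z + \<tau>) = automorphy \<tau> p z * f z)"
  by (auto simp: quasi_periodic_def automorphy_def)

lemma smooth_fun_has_derivative:
  assumes "smooth_fun f"
  shows "(f has_derivative frechet_derivative f (at z)) (at z)"
proof -
  have "C_diff (Suc 0) f"
    using assms unfolding smooth_fun_def by blast
  then show ?thesis
    by (simp flip: frechet_derivative_works)
qed

lemma smooth_fun_frechet_derivative:
  "smooth_fun f \<Longrightarrow> smooth_fun (\<lambda>z. frechet_derivative f (at z) v)"
  unfolding smooth_fun_def using C_diff.simps(2) by blast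

lemma frechet_derivative_complex:
  assumes "smooth_fun f"
  shows "frechet_derivative f (at z) v =
    of_real (Re v) * frechet_derivative f (at z) 1 + of_real (Im v) * frechet_derivative f (at z) \<i>"
proof -
  have lin: "linear (frechet_derivative f (at z))"
    using has_derivative_linear[OF smooth_fun_has_derivative[OF assms]] .
  have "v = Re v *\<^sub>R 1 + Im v *\<^sub>R \<i>"
    by (simp add: complex_eq_iff)
  then show ?thesis
    using linear_add[OF lin, of "Re v *\<^sub>R 1" "Im v *\<^sub>R \<i>"] 
      linear_scale[OF lin, of "Re v" 1] linear_scale[OF lin, of "Im v" \<i>]
    by (simp add: scaleR_conv_of_real)
qed

lemma has_derivative_translate:
  fixes f :: "complex \<Rightarrow> complex"
  assumes "(f has_derivative f') (at (z + s))"
  shows "((\<lambda>z. f (z + s)) has_derivative f') (at z)"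
proof -
  have "((\<lambda>z. z + s) has_derivative (\<lambda>v. v)) (at z)"
    by (auto intro!: derivative_eq_intros)
  from has_derivative_compose[OF this assms] show ?thesis
    by simp
qed

context
  fixes f :: "complex \<Rightarrow> complex" and \<tau> :: complex and p :: int
  assumes f: "f \<in> quasi_periodic \<tau> p"
begin

lemma quasi_periodic_smooth: "smooth_fun f"
  and quasi_periodic_plus_1: "f (z + 1) = f z"
  and quasi_periodic_plus_tau: "f (z + \<tau>) = automorphy \<tau> p z * f z"
  using f by (auto simp: quasi_periodic_iff)

lemma quasi_periodic_derivative_plus_1:
  "frechet_derivative f (at (z + 1)) = frechet_derivative f (at z)"
proof -
  have "((\<lambda>z. f (z + 1)) has_derivative frechet_derivative f (at (z + 1))) (at z)"
    by (rule has_derivative_translate[OF smooth_fun_has_derivative[OF quasi_periodic_smooth]])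
  then show ?thesis
    using has_derivative_unique smooth_fun_has_derivative[OF quasi_periodic_smooth]
    by (simp add: quasi_periodic_plus_1) blast
qed

text \<open>Obtained by differentiating the functional equation. The extra term is the derivative of
  the automorphy factor, which depends on x alone; it therefore vanishes for
  \<open>v = \<i>\<close>.\<close>

lemma quasi_periodic_derivative_plus_tau:
  "frechet_derivative f (at (z + \<tau>)) v = automorphy \<tau> p z *
     (frechet_derivative f (at z) v - 2 * of_real pi * \<i> * of_int p * of_real (Re v) * f z)"
proof -
  have "((\<lambda>z. f (z + \<tau>)) has_derivative frechet_derivative f (at (z + \<tau>))) (at z)"
    by (rule has_derivative_translate[OF smooth_fun_has_derivative[OF quasi_periodic_smooth]])
  moreover have "((\<lambda>z. f (z + \<tau>)) has_derivative
      (\<lambda>v. automorphy \<tau> p z * frechet_derivative f (at z) v +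
        automorphy \<tau> p z * (- 2 * of_real pi * \<i> * of_int p * of_real (Re v)) * f z)) (at z)"
    unfolding quasi_periodic_plus_tau
    by (rule has_derivative_mult[OF automorphy_has_derivative smooth_fun_has_derivative[OF quasi_periodic_smooth]])
  ultimately have "frechet_derivative f (at (z + \<tau>)) = (\<lambda>v. automorphy \<tau> p z * frechet_derivative f (at z) v +
        automorphy \<tau> p z * (- 2 * of_real pi * \<i> * of_int p * of_real (Re v)) * f z)"
    by (rule has_derivative_unique)
  then show ?thesis
    by (simp add: algebra_simps)
qed

lemma quasi_periodic_partial_y: "(\<lambda>z. frechet_derivative f (at z) \<i>) \<in> quasi_periodic \<tau> p"
  unfolding quasi_periodic_iff
  using smooth_fun_frechet_derivative[OF quasi_periodic_smooth]
  by (simp add: quasi_periodic_derivative_plus_1 quasi_periodic_derivative_plus_tau)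

text \<open>The derivative in the direction of \<open>x\<close> does not preserve quasi-periodicity; the correction by
  a multiple of \<open>y\<close> makes it a connection that does.\<close>

lemma quasi_periodic_covariant_x:
  assumes "\<kappa> * of_real (Im \<tau>) = 2 * of_real pi * \<i> * of_int p"
  shows "(\<lambda>z. frechet_derivative f (at z) 1 + \<kappa> * of_real (Im z) * f z) \<in> quasi_periodic \<tau> p"
proof -
  have "C_diff k (\<lambda>z. frechet_derivative f (at z) 1 + \<kappa> * of_real (Im z) * f z)" for k
    using smooth_fun_frechet_derivative[OF quasi_periodic_smooth, of 1] quasi_periodic_smooth
    by (intro C_diff_add C_diff_mult C_diff_const C_diff_Im) (simp_all add: smooth_fun_def)
  moreover have "frechet_derivative f (at (z + \<tau>)) 1 + \<kappa> * of_real (Im (z + \<tau>)) * f (z + \<tau>)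
      = automorphy \<tau> p z * (frechet_derivative f (at z) 1 + \<kappa> * of_real (Im z) * f z)" for z
  proof -
    \<comment> \<open>Translation by tau raises y by Im tau, so the correction gains \<kappa> Im tau
      f. By the choice of \<kappa> this cancels the extra term of the derivative.\<close>
    have "frechet_derivative f (at (z + \<tau>)) 1 + \<kappa> * of_real (Im (z + \<tau>)) * f (z + \<tau>)
        = automorphy \<tau> p z * (frechet_derivative f (at z) 1 - (2 * of_real pi * \<i> * of_int p) * f z
          + \<kappa> * of_real (Im z) * f z + (\<kappa> * of_real (Im \<tau>)) * f z)"
      unfolding quasi_periodic_derivative_plus_tau quasi_periodic_plus_tau
      by (simp add: distrib_left distrib_right right_diff_distrib)
    then show ?thesis
      unfolding assms by simp
  qed
  ultimately show ?thesis
    unfolding quasi_periodic_iff smooth_fun_def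
    by (simp add: quasi_periodic_derivative_plus_1 quasi_periodic_plus_1)
qed

text \<open>The automorphy factor has modulus 1, so |f| is invariant under the lattice spanned by 1
  and tau and is determined by its values on a compact rectangle.\<close>

lemma quasi_periodic_bounded:
  assumes "Im \<tau> > 0"
  shows "\<exists>B. \<forall>z. cmod (f z) \<le> B"
proof -
  have tau: "cmod (f (z + of_int k * \<tau>)) = cmod (f z)" for z k
  proof (induction k rule: int_induct[where k = 0])
    case (step1 i)
    have *: "z + of_int (i + 1) * \<tau> = (z + of_int i * \<tau>) + \<tau>"
      by (simp add: algebra_simps)
    then show ?case
      using step1 unfolding * quasi_periodic_plus_tau by (simp add: norm_mult)
  next
    case (step2 i)
    have *: "z + of_int i * \<tau> = (z + of_int (i - 1) * \<tau>) + \<tau>"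
      by (simp add: algebra_simps)
    then show ?case
      using step2 unfolding * quasi_periodic_plus_tau by (simp add: norm_mult)
  qed simp
  have one: "f (z + of_int k) = f z" for z k
  proof (induction k rule: int_induct[where k = 0])
    case (step1 i)
    have *: "z + of_int (i + 1) = (z + of_int i) + 1"
      by (simp add: algebra_simps)
    then show ?case
      using step1 unfolding * quasi_periodic_plus_1 by simp
  next
    case (step2 i)
    have *: "z + of_int i = (z + of_int (i - 1)) + 1"
      by (simp add: algebra_simps)
    then show ?case
      using step2 unfolding * quasi_periodic_plus_1 by simp
  qed simp
  have "C_diff 0 f"
    using quasi_periodic_smooth unfolding smooth_fun_def by blast
  then have "compact (f ` cbox 0 (Complex 1 (Im \<tau>)))"
    by (intro compact_continuous_image) (auto intro: continuous_on_subset)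
  then obtain B where B: "\<And>z. z \<in> cbox 0 (Complex 1 (Im \<tau>)) \<Longrightarrow> cmod (f z) \<le> B"
    using compact_imp_bounded bounded_iff by (metis imageI)
  have "cmod (f z) \<le> B" for z
  proof -
    \<comment> \<open>A multiple of tau first brings the height into [0, Im tau]; an integer
      translation then adjusts the real part and keeps the height.\<close>
    define k where "k = \<lfloor>Im z / Im \<tau>\<rfloor>"
    define w where "w = z + of_int (- k) * \<tau>"
    define l where "l = \<lfloor>Re w\<rfloor>"
    define u where "u = w + of_int (- l)"
    have "0 \<le> Im z - of_int k * Im \<tau> \<and> Im z - of_int k * Im \<tau> \<le> Im \<tau>"
    proof -
      have "of_int k \<le> Im z / Im \<tau>" "Im z / Im \<tau> \<le> of_int k + 1"
        unfolding k_def by linarith+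
      then show ?thesis
        using assms by (simp add: pos_le_divide_eq pos_divide_le_eq algebra_simps)
    qed
    moreover have "0 \<le> Re u \<and> Re u \<le> 1"
      unfolding u_def l_def by simp linarith
    ultimately have "u \<in> cbox 0 (Complex 1 (Im \<tau>))"
      by (simp add: in_cbox_complex_iff u_def w_def)
    moreover have "cmod (f u) = cmod (f z)"
      unfolding u_def one unfolding w_def tau ..
    ultimately show ?thesis
      using B by metis
  qed
  then show ?thesis
    by blast
qed

end

section \<open>Smoothness of twisted series\<close>

lemma phase_has_derivative:
  "(phase \<theta> q has_derivative (\<lambda>v. phase \<theta> q z *
     (2 * of_real pi * \<i> * of_real (of_int (fst q) * Re v + of_int (snd q) * Im v)))) (at z)"
proof -
  have "phase \<theta> q = (\<lambda>z. exp (2 * of_real pi * \<i> *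
     of_real (of_int (fst q) * Re z + of_int (snd q) * Im z + of_int (fst q) * of_int (snd q) * \<theta> / 2)))"
    by (auto simp: phase_def fun_eq_iff split: prod.split)
  then show ?thesis
    by (simp only:) (rule has_derivative_exp_compose, auto intro!: derivative_eq_intros)
qed

definition twisted_term ::
    "real \<Rightarrow> (complex \<Rightarrow> complex) \<Rightarrow> (int \<times> int \<Rightarrow> complex) \<Rightarrow> int \<times> int \<Rightarrow> complex \<Rightarrow> complex" where
  "twisted_term \<theta> f a q z = a q * (phase \<theta> q z * f (z + shift \<theta> q))"

lemma twisted_series_eq: "twisted_series \<theta> f a z = (\<Sum>\<^sub>\<infinity>q. twisted_term \<theta> f a q z)"
  by (simp add: twisted_series_def twisted_term_def)

lemma norm_twisted_term_le:
  "(\<And>z. cmod (f z) \<le> B) \<Longrightarrow> cmod (twisted_term \<theta> f a q z) \<le> B * cmod (a q)"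
  by (simp add: twisted_term_def norm_mult mult.commute[of B] mult_left_mono)

lemma twisted_term_summable:
  assumes "\<And>z. cmod (f z) \<le> B" "rapidly_decreasing a"
  shows "(\<lambda>q. twisted_term \<theta> f a q z) summable_on UNIV"
  by (rule Infinite_Sum.abs_summable_summable,
    rule Infinite_Sum.abs_summable_on_comparison_test'[where g = "\<lambda>q. B * cmod (a q)"])
    (use norm_twisted_term_le[OF assms(1)] rapidly_decreasing_summable[OF assms(2)] in \<open>auto intro: summable_on_cmult_right\<close>)

lemma twisted_term_has_sum:
  "(\<And>z. cmod (f z) \<le> B) \<Longrightarrow> rapidly_decreasing a \<Longrightarrow>
    ((\<lambda>q. twisted_term \<theta> f a q z) has_sum twisted_series \<theta> f a z) UNIV"
  unfolding twisted_series_eq by (intro has_sum_infsum twisted_term_summable)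

lemma rapidly_decreasing_fst: "rapidly_decreasing a \<Longrightarrow> rapidly_decreasing (\<lambda>q. c * of_int (fst q) * a q)"
  by (erule rapidly_decreasing_weight[where B = "(cmod c)\<^sup>2"])
    (simp add: norm_mult power_mult_distrib mult_left_mono)

lemma rapidly_decreasing_snd: "rapidly_decreasing a \<Longrightarrow> rapidly_decreasing (\<lambda>q. c * of_int (snd q) * a q)"
  by (erule rapidly_decreasing_weight[where B = "(cmod c)\<^sup>2"])
    (simp add: norm_mult power_mult_distrib mult_left_mono)

text \<open>All series on the right are again built from quasi-periodic functions and rapidly
  decreasing coefficients, so the formula can be iterated. In \<open>a1\<close> the summand 2 pi i
  comes from differentiating the phase, and \<kappa> theta / 2 from the correction in
  \<open>f1\<close>, taken at the shifted height.\<close>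

lemma twisted_series_has_derivative:
  fixes \<tau> :: complex and p :: int and \<theta> :: real
  assumes tau: "Im \<tau> > 0" and f: "f \<in> quasi_periodic \<tau> p" and a: "rapidly_decreasing a"
  defines "\<kappa> \<equiv> 2 * of_real pi * \<i> * of_int p / of_real (Im \<tau>)"
  defines "f1 \<equiv> (\<lambda>z. frechet_derivative f (at z) 1 + \<kappa> * of_real (Im z) * f z)"
  defines "f2 \<equiv> (\<lambda>z. frechet_derivative f (at z) \<i>)"
  defines "a1 \<equiv> (\<lambda>q. (2 * of_real pi * \<i> + \<kappa> * of_real (\<theta> / 2)) * of_int (fst q) * a q)"
  defines "a2 \<equiv> (\<lambda>q. 2 * of_real pi * \<i> * of_int (snd q) * a q)"
  shows "(twisted_series \<theta> f a has_derivative (\<lambda>v.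
      of_real (Re v) * (twisted_series \<theta> f a1 z + twisted_series \<theta> f1 a z
        - \<kappa> * of_real (Im z) * twisted_series \<theta> f a z) +
      of_real (Im v) * (twisted_series \<theta> f a2 z + twisted_series \<theta> f2 a z))) (at z)"
proof -
  have \<kappa>: "\<kappa> * of_real (Im \<tau>) = 2 * of_real pi * \<i> * of_int p"
    using tau by (simp add: \<kappa>_def)
  have f1: "f1 \<in> quasi_periodic \<tau> p" and f2: "f2 \<in> quasi_periodic \<tau> p"
    unfolding f1_def f2_def
    by (rule quasi_periodic_covariant_x[OF f \<kappa>], rule quasi_periodic_partial_y[OF f])
  obtain B0 B1 B2 where B012: "\<And>z. cmod (f z) \<le> B0" "\<And>z. cmod (f1 z) \<le> B1" "\<And>z. cmod (f2 z) \<le> B2"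
    using quasi_periodic_bounded[OF f tau] quasi_periodic_bounded[OF f1 tau]
      quasi_periodic_bounded[OF f2 tau] by blast
  define B where "B = max B0 (max B1 B2)"
  have B: "cmod (f z) \<le> B" "cmod (f1 z) \<le> B" "cmod (f2 z) \<le> B" for z
    using B012[of z] by (auto simp: B_def)
  have B_nonneg: "B \<ge> 0"
    using B(1)[of 0] norm_ge_zero order_trans by blast
  have a1: "rapidly_decreasing a1" and a2: "rapidly_decreasing a2"
    unfolding a1_def a2_def using a
    by (intro rapidly_decreasing_fst rapidly_decreasing_snd; assumption)+
  define D where "D q z v =
      of_real (Re v) * (twisted_term \<theta> f a1 q z + twisted_term \<theta> f1 a q z
        - \<kappa> * of_real (Im z) * twisted_term \<theta> f a q z) +
      of_real (Im v) * (twisted_term \<theta> f a2 q z + twisted_term \<theta> f2 a q z)" for q z v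
  have der: "(twisted_term \<theta> f a q has_derivative D q z) (at z)" for q z
  proof -
    define w where "w = z + shift \<theta> q"
    have Im_w: "Im w = Im z - of_int (fst q) * \<theta> / 2"
      by (cases q) (simp add: w_def shift_def)
    have "(f has_derivative frechet_derivative f (at w)) (at w)"
      using f by (intro smooth_fun_has_derivative) (simp add: quasi_periodic_iff)
    then have "((\<lambda>z. f (z + shift \<theta> q)) has_derivative frechet_derivative f (at w)) (at z)"
      unfolding w_def by (rule has_derivative_translate)
    from has_derivative_mult_right[OF has_derivative_mult[OF phase_has_derivative[of \<theta> q z] this], of "a q"]
    have "((\<lambda>z. a q * (phase \<theta> q z * f (z + shift \<theta> q))) has_derivative
        (\<lambda>v. a q * (phase \<theta> q z * frechet_derivative f (at w) v + phase \<theta> q z *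
          (2 * of_real pi * \<i> * of_real (of_int (fst q) * Re v + of_int (snd q) * Im v)) * f w))) (at z)"
      by (simp add: w_def)
    moreover have "a q * (phase \<theta> q z * frechet_derivative f (at w) v + phase \<theta> q z *
          (2 * of_real pi * \<i> * of_real (of_int (fst q) * Re v + of_int (snd q) * Im v)) * f w) = D q z v" for v
    proof -
      have eq: "frechet_derivative f (at w) v
          = of_real (Re v) * (f1 w - \<kappa> * of_real (Im w) * f w) + of_real (Im v) * f2 w"
        using frechet_derivative_complex[of f w v] f by (simp add: quasi_periodic_iff f1_def f2_def)
      then show ?thesis
        unfolding D_def twisted_term_def a1_def a2_def w_def[symmetric] eq Im_w
        by (simp add: algebra_simps)
    qed
    ultimately show ?thesis
      unfolding twisted_term_def by simp
  qed
  have "((\<lambda>z. \<Sum>\<^sub>\<infinity>q. twisted_term \<theta> f a q z) has_derivative (\<lambda>v. \<Sum>\<^sub>\<infinity>q. D q z v)) (at z)"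
  proof (rule has_derivative_infsum[OF _ der])
    show "infinite (UNIV :: (int \<times> int) set)"
      by (simp add: finite_prod)
    show "\<exists>b. b summable_on UNIV \<and> (\<forall>q z. cmod z < R \<longrightarrow> cmod (twisted_term \<theta> f a q z) \<le> b q \<and>
        (\<forall>v. cmod (D q z v) \<le> b q * cmod v))" for R
    proof (intro exI conjI allI impI)
      \<comment> \<open>One summand for each of the five twisted terms in \<open>D\<close>. |R|
        bounds |Im z|, the only factor not bounded on the plane; the absolute value keeps
        \<open>b\<close> nonnegative when R is negative and the condition on z is void.\<close>
      define b where "b q = B * cmod (a1 q) + B * cmod (a q) + cmod \<kappa> * \<bar>R\<bar> * (B * cmod (a q))
        + (B * cmod (a2 q) + B * cmod (a q))" for q
      show "b summable_on UNIV"
        unfolding b_def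
        by (intro summable_on_add summable_on_cmult_right rapidly_decreasing_summable a a1 a2)
      fix q z
      assume z: "cmod z < R"
      have le: "cmod (twisted_term \<theta> f a q z) \<le> B * cmod (a q)"
          "cmod (twisted_term \<theta> f a1 q z) \<le> B * cmod (a1 q)"
          "cmod (twisted_term \<theta> f a2 q z) \<le> B * cmod (a2 q)"
          "cmod (twisted_term \<theta> f1 a q z) \<le> B * cmod (a q)"
          "cmod (twisted_term \<theta> f2 a q z) \<le> B * cmod (a q)"
        using B by (intro norm_twisted_term_le; blast)+
      have nonneg: "0 \<le> B * cmod c" for c :: complex
        using B_nonneg by simp
      have "0 \<le> cmod \<kappa> * \<bar>R\<bar> * (B * cmod (a q))"
        using nonneg by simp
      then show "cmod (twisted_term \<theta> f a q z) \<le> b q"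
        using le(1) nonneg[of "a1 q"] nonneg[of "a2 q"] nonneg[of "a q"] unfolding b_def by linarith
      have "cmod (\<kappa> * of_real (Im z) * twisted_term \<theta> f a q z) = cmod \<kappa> * \<bar>Im z\<bar> * cmod (twisted_term \<theta> f a q z)"
        by (simp add: norm_mult)
      also have "\<dots> \<le> cmod \<kappa> * \<bar>R\<bar> * (B * cmod (a q))"
        using z abs_Im_le_cmod[of z] le(1) by (intro mult_mono) auto
      finally have "cmod (twisted_term \<theta> f a1 q z + twisted_term \<theta> f1 a q z
          - \<kappa> * of_real (Im z) * twisted_term \<theta> f a q z)
          \<le> B * cmod (a1 q) + B * cmod (a q) + cmod \<kappa> * \<bar>R\<bar> * (B * cmod (a q))" (is "cmod ?x \<le> ?M")
        using le
        by (intro order_trans[OF norm_triangle_ineq4] order_trans[OF norm_triangle_ineq] add_mono)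
      moreover have "cmod (twisted_term \<theta> f a2 q z + twisted_term \<theta> f2 a q z) \<le> B * cmod (a2 q) + B * cmod (a q)"
          (is "cmod ?y \<le> ?N")
        using le by (intro order_trans[OF norm_triangle_ineq] add_mono)
      ultimately have xy: "cmod ?x \<le> ?M" "cmod ?y \<le> ?N"
        by blast+
      fix v :: complex
      have "cmod (D q z v) \<le> \<bar>Re v\<bar> * cmod ?x + \<bar>Im v\<bar> * cmod ?y"
        unfolding D_def by (rule order_trans[OF norm_triangle_ineq]) (simp add: norm_mult)
      also have "\<dots> \<le> cmod v * ?M + cmod v * ?N"
        using xy abs_Re_le_cmod[of v] abs_Im_le_cmod[of v] by (intro add_mono mult_mono) auto
      finally show "cmod (D q z v) \<le> b q * cmod v"
        by (simp add: b_def algebra_simps)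
    qed
  qed
  moreover have "((\<lambda>q. D q z v) has_sum
      (of_real (Re v) * (twisted_series \<theta> f a1 z + twisted_series \<theta> f1 a z
        - \<kappa> * of_real (Im z) * twisted_series \<theta> f a z) +
      of_real (Im v) * (twisted_series \<theta> f a2 z + twisted_series \<theta> f2 a z))) UNIV" for v
    unfolding D_def diff_conv_add_uminus minus_mult_left
    by (intro has_sum_add has_sum_cmult_right twisted_term_has_sum[OF B(1)]
        twisted_term_has_sum[OF B(2)] twisted_term_has_sum[OF B(3)] a a1 a2)
  then have "(\<Sum>\<^sub>\<infinity>q. D q z v) = of_real (Re v) * (twisted_series \<theta> f a1 z + twisted_series \<theta> f1 a z
        - \<kappa> * of_real (Im z) * twisted_series \<theta> f a z) +
      of_real (Im v) * (twisted_series \<theta> f a2 z + twisted_series \<theta> f2 a z)" for v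
    by (rule infsumI)
  ultimately show ?thesis
    unfolding twisted_series_eq[abs_def] by simp
qed

lemma twisted_series_smooth:
  assumes tau: "Im \<tau> > 0" and "f \<in> quasi_periodic \<tau> p" "rapidly_decreasing a"
  shows "smooth_fun (twisted_series \<theta> f a)"
  unfolding smooth_fun_def
proof
  fix k
  show "C_diff k (twisted_series \<theta> f a)"
    using assms(2,3)
  \<comment> \<open>Both \<open>f\<close> and \<open>a\<close> must vary, because the derivative
    contains series with corrected derivatives of \<open>f\<close> and with weighted
    coefficients.\<close>
  proof (induction k arbitrary: f a)
    case 0
    show ?case
      using twisted_series_has_derivative[OF tau 0] has_derivative_continuous
      by (simp add: continuous_on_eq_continuous_at) blast
  next
    case (Suc k)
    define \<kappa> where "\<kappa> = 2 * of_real pi * \<i> * of_int p / of_real (Im \<tau>)"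
    have \<kappa>: "\<kappa> * of_real (Im \<tau>) = 2 * of_real pi * \<i> * of_int p"
      using tau by (simp add: \<kappa>_def)
    show ?case
      unfolding C_diff_Suc_iff[OF twisted_series_has_derivative[OF tau Suc.prems, folded \<kappa>_def]] diff_conv_add_uminus
        minus_mult_left
      by (intro allI C_diff_add C_diff_mult C_diff_const C_diff_Im Suc.IH Suc.prems quasi_periodic_covariant_x[OF Suc.prems(1) \<kappa>]
          quasi_periodic_partial_y[OF Suc.prems(1)] rapidly_decreasing_fst rapidly_decreasing_snd)
  qed
qed

section \<open>Quasi-periodicity of twisted series\<close>

lemma exp_2pi_i_int [simp]: "exp (2 * of_real pi * \<i> * of_int k) = 1"
  using exp_integer_2pi[of "of_int k"] by (simp add: mult_ac)

text \<open>Translating the phase by tau contributes m Re tau + n Im tau. The shift moves x by n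
  theta / 2, and there the automorphy factor changes by exp (- pi i p n theta): this is the origin
  of p theta / 2.\<close>

lemma phase_automorphy:
  "phase \<theta> (m, n) (z + \<tau>) * automorphy \<tau> p (z + shift \<theta> (m, n)) = automorphy \<tau> p z * phase \<theta> (m, n) z *
     exp (2 * of_real pi * \<i> * of_real (of_int m * Re \<tau> + of_int n * (Im \<tau> - of_int p * \<theta> / 2)))"
  unfolding phase_def automorphy_def shift_def prod.case exp_add[symmetric]
  by (intro arg_cong[of _ _ exp]) (simp add: algebra_simps)

lemma twisted_series_quasi_periodic:
  assumes tau: "Im \<tau> > 0" and f: "f \<in> quasi_periodic \<tau> p" and a: "rapidly_decreasing a"
    and k: "Re \<tau> = of_int k" and l: "Im \<tau> - of_int p * \<theta> / 2 = of_int l"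
  shows "twisted_series \<theta> f a \<in> quasi_periodic \<tau> p"
proof -
  have phase1: "phase \<theta> q (z + 1) = phase \<theta> q z" for q z
  proof (cases q)
    case (Pair m n)
    have "phase \<theta> (m, n) (z + 1) = phase \<theta> (m, n) z * exp (2 * of_real pi * \<i> * of_int m)"
      unfolding phase_def prod.case exp_add[symmetric]
      by (rule arg_cong[of _ _ exp]) (simp add: algebra_simps)
    then show ?thesis
      by (simp add: Pair)
  qed
  have "f (z + 1 + s) = f (z + s)" for z s
    using quasi_periodic_plus_1[OF f, of "z + s"] by (simp add: ac_simps)
  then have "twisted_series \<theta> f a (z + 1) = twisted_series \<theta> f a z" for z
    unfolding twisted_series_def by (simp add: phase1)
  moreover have term_tau: "phase \<theta> q (z + \<tau>) * f (z + \<tau> + shift \<theta> q)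
      = automorphy \<tau> p z * (phase \<theta> q z * f (z + shift \<theta> q))" for q z
  proof (cases q)
    case (Pair m n)
    have "phase \<theta> (m, n) (z + \<tau>) * automorphy \<tau> p (z + shift \<theta> (m, n))
        = automorphy \<tau> p z * phase \<theta> (m, n) z * exp (2 * of_real pi * \<i> * of_int (m * k + n * l))"
      unfolding phase_automorphy k l by simp
    moreover have "f (z + \<tau> + shift \<theta> q) = automorphy \<tau> p (z + shift \<theta> q) * f (z + shift \<theta> q)"
      using quasi_periodic_plus_tau[OF f, of "z + shift \<theta> q"] by (simp add: ac_simps)
    ultimately show ?thesis
      unfolding Pair exp_2pi_i_int by (metis mult.assoc mult.right_neutral)
  qed
  have "twisted_series \<theta> f a (z + \<tau>) = automorphy \<tau> p z * twisted_series \<theta> f a z" for z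
    unfolding twisted_series_def term_tau infsum_cmult_right'[symmetric]
    by (intro infsum_cong) (simp add: mult_ac)
  ultimately show ?thesis
    using twisted_series_smooth[OF tau f a] by (simp add: quasi_periodic_iff)
qed

section \<open>A theta function and a nonzero quasi-periodic function\<close>

context
  fixes \<alpha> :: real
begin

text \<open>This is exp (pi i t n^2) with t = \<alpha> + i, so \<open>theta\<close> is Jacobi's
  theta function with parameter t.\<close>

definition theta_coeff :: "int \<Rightarrow> complex" where
  "theta_coeff n = exp (of_real pi * (\<i> * of_real \<alpha> - 1) * (of_int n)\<^sup>2)"

definition theta_series :: "complex \<Rightarrow> complex" where
  "theta_series q = (\<Sum>n. theta_coeff (int n) * q ^ n)"

text \<open>The bilateral sum split into two power series, so that \<open>theta\<close> is visibly
  entire once \<open>theta_series\<close> is. The term n = 0 occurs in both, hence the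
  \<open>- 1\<close>.\<close>

definition theta :: "complex \<Rightarrow> complex" where
  "theta w = theta_series (exp (- (2 * of_real pi * \<i> * w))) + theta_series (exp (2 * of_real pi * \<i> * w)) - 1"

lemma theta_coeff_0 [simp]: "theta_coeff 0 = 1"
  by (simp add: theta_coeff_def)

lemma theta_coeff_uminus: "theta_coeff (- n) = theta_coeff n"
  by (simp add: theta_coeff_def)

lemma norm_theta_coeff_le: "cmod (theta_coeff (int n)) \<le> exp (- pi) ^ n"
proof -
  have "cmod (theta_coeff (int n)) = exp (- pi * (real n)\<^sup>2)"
    by (simp add: theta_coeff_def power2_eq_square)
  also have "\<dots> \<le> exp (- pi * real n)"
    by (cases n) (auto simp: power2_eq_square)
  also have "\<dots> = exp (- pi) ^ n"
    by (simp flip: exp_of_nat_mult add: mult.commute)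
  finally show ?thesis .
qed

lemma theta_series_abs_summable: "summable (\<lambda>n. cmod (theta_coeff (int n) * q ^ n))"
proof -
  \<comment> \<open>The n-th root of the n-th term has modulus exp (- pi n) |q|, which is at most
    1/2 from N on.\<close>
  obtain N :: nat where N: "exp (- pi * real N) * cmod q \<le> 1 / 2"
  proof -
    have "(\<lambda>n. exp (- pi * real n) * cmod q) \<longlonglongrightarrow> 0"
      by real_asymp
    then have "\<forall>\<^sub>F n in sequentially. exp (- pi * real n) * cmod q < 1 / 2"
      by (rule order_tendstoD) simp
    then obtain N where "exp (- pi * real N) * cmod q < 1 / 2"
      unfolding eventually_sequentially by blast
    then show ?thesis
      using that[of N] by simp
  qed
  have "cmod (theta_coeff (int n) * q ^ n) \<le> (1 / 2) ^ n" if "n \<ge> N" for n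
  proof -
    have "cmod (theta_coeff (int n) * q ^ n) = exp (- pi * (real n)\<^sup>2) * cmod q ^ n"
      by (simp add: theta_coeff_def power2_eq_square norm_mult norm_power)
    also have "exp (- pi * (real n)\<^sup>2) = exp (- pi * real n) ^ n"
      by (simp add: power2_eq_square flip: exp_of_nat_mult)
    also have "exp (- pi * real n) ^ n * cmod q ^ n = (exp (- pi * real n) * cmod q) ^ n"
      by (simp add: power_mult_distrib)
    also have "\<dots> \<le> (exp (- pi * real N) * cmod q) ^ n"
      using that by (intro power_mono mult_right_mono) auto
    also have "\<dots> \<le> (1 / 2) ^ n"
      using N by (intro power_mono) auto
    finally show ?thesis .
  qed
  then show ?thesis
    by (intro summable_comparison_test[OF _ summable_geometric[of "1 / 2 :: real"]]) auto
qed

lemma theta_series_holomorphic: "theta_series holomorphic_on UNIV"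
proof -
  have "theta_series holomorphic_on ball 0 r" for r
  proof (rule power_series_holomorphic)
    show "(\<lambda>n. theta_coeff (int n) * (w - 0) ^ n) sums theta_series w" for w
      unfolding theta_series_def using summable_norm_cancel[OF theta_series_abs_summable]
      by (simp add: summable_sums)
  qed
  then have "theta_series field_differentiable at w" for w
    using holomorphic_on_imp_differentiable_at[of theta_series "ball 0 (norm w + 1)" w] by simp
  then show ?thesis
    by (simp add: holomorphic_on_def field_differentiable_at_within)
qed

lemma theta_holomorphic: "theta holomorphic_on UNIV"
proof -
  have comp: "(\<lambda>w. theta_series (g w)) holomorphic_on UNIV" if "g holomorphic_on UNIV" for g
    using holomorphic_on_compose_gen[OF that theta_series_holomorphic] by (simp add: o_def)
  have "(\<lambda>w. theta_series (exp (- (2 * of_real pi * \<i> * w)))) holomorphic_on UNIV"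
    "(\<lambda>w. theta_series (exp (2 * of_real pi * \<i> * w))) holomorphic_on UNIV"
    by (rule comp, intro holomorphic_intros)+
  then show ?thesis
    unfolding theta_def[abs_def]
    by (intro holomorphic_on_add holomorphic_on_diff holomorphic_on_const)
qed

text \<open>The bilateral form, in which translation by the quasi-period becomes a shift of the
  index.\<close>

lemma theta_has_sum:
  "((\<lambda>n. theta_coeff n * exp (- (2 * of_real pi * \<i> * of_int n * w))) has_sum theta w) UNIV"
proof -
  define q where "q = exp (- (2 * of_real pi * \<i> * w))"
  define q' where "q' = exp (2 * of_real pi * \<i> * w)"
  have s: "((\<lambda>n. theta_coeff (int n) * r ^ n) has_sum theta_series r) UNIV" for r
    unfolding theta_series_def
    using theta_series_abs_summable[of r] summable_norm_cancel
    by (intro norm_summable_imp_has_sum summable_sums) auto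
  have pos: "((\<lambda>n. theta_coeff n * exp (- (2 * of_real pi * \<i> * of_int n * w))) has_sum theta_series q) (range int)"
    using s[of q]
    by (subst has_sum_reindex) (auto simp: o_def q_def mult_ac simp flip: exp_of_nat_mult)
  have "((\<lambda>n. theta_coeff (int n) * q' ^ n) has_sum (theta_series q' - 1)) (UNIV - {0})"
    using has_sum_Diff[OF s[of q'], of "{0}" 1] has_sum_finite[of "{0}" "\<lambda>n. theta_coeff (int n) * q' ^ n"] by simp
  then have neg: "((\<lambda>n. theta_coeff n * exp (- (2 * of_real pi * \<i> * of_int n * w))) has_sum (theta_series q' - 1))
      ((\<lambda>n. - int n) ` (UNIV - {0}))"
    by (subst has_sum_reindex)
      (auto simp: o_def q'_def theta_coeff_uminus mult_ac inj_on_def simp flip: exp_of_nat_mult)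
  have "k \<in> range int \<union> (\<lambda>n. - int n) ` (UNIV - {0})" for k
    by (cases k rule: int_cases) force+
  then have "range int \<union> (\<lambda>n. - int n) ` (UNIV - {0}) = UNIV"
    using UNIV_eq_I by metis
  moreover have "range int \<inter> (\<lambda>n. - int n) ` (UNIV - {0}) = {}"
    by auto
  ultimately show ?thesis
    using has_sum_Un_disjoint[OF pos neg] by (simp add: theta_def q_def q'_def add_diff_eq)
qed

lemma theta_plus_int: "theta (w + of_int k) = theta w"
proof -
  have eq: "theta_coeff n * exp (- (2 * of_real pi * \<i> * of_int n * (w + of_int k)))
      = theta_coeff n * exp (- (2 * of_real pi * \<i> * of_int n * w))" for n
  proof -
    have "exp (- (2 * of_real pi * \<i> * of_int n * (w + of_int k)))
        = exp (- (2 * of_real pi * \<i> * of_int n * w)) * exp (2 * of_real pi * \<i> * of_int (- (n * k)))"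
      unfolding exp_add[symmetric] by (rule arg_cong[of _ _ exp]) (simp add: algebra_simps)
    then show ?thesis
      unfolding exp_2pi_i_int by simp
  qed
  show ?thesis
    using has_sum_unique[OF theta_has_sum[of "w + of_int k", unfolded eq] theta_has_sum[of w]] .
qed

text \<open>Completing the square: the term of index n + 1 at the translated point is a constant
  multiple, independent of n, of the term of index n at w.\<close>

lemma theta_plus_period:
  "theta (w + of_real \<alpha> + \<i>) = exp (- (of_real pi * \<i> * of_real \<alpha>) + of_real pi - 2 * of_real pi * \<i> * w) * theta w"
proof -
  define c where "c = exp (- (of_real pi * \<i> * of_real \<alpha>) + of_real pi - 2 * of_real pi * \<i> * w)"
  define t where "t u n = theta_coeff n * exp (- (2 * of_real pi * \<i> * of_int n * u))" for u n
  have t: "t (w + of_real \<alpha> + \<i>) (n + 1) = c * t w n" for n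
    unfolding t_def theta_coeff_def c_def exp_add[symmetric]
    by (rule arg_cong[of _ _ exp]) (simp add: algebra_simps power2_eq_square)
  have "(t (w + of_real \<alpha> + \<i>) has_sum c * theta w) (range (\<lambda>n. n + 1))"
    using has_sum_cmult_right[OF theta_has_sum[of w, folded t_def], of c]
    by (subst has_sum_reindex) (auto simp: o_def t)
  moreover have "range (\<lambda>n::int. n + 1) = UNIV"
    by (auto intro!: image_eqI[of _ _ "_ - 1"])
  moreover have "(t (w + of_real \<alpha> + \<i>) has_sum theta (w + of_real \<alpha> + \<i>)) UNIV"
    unfolding t_def by (rule theta_has_sum)
  ultimately show ?thesis
    unfolding c_def using has_sum_unique by metis
qed

text \<open>Theta at 0 is 1 plus twice the sum over n >= 1. Since exp pi >= 1 + pi >= 4, that sum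
  has modulus at most 1/4 + 1/16 + ... = 1/3, so at least 1/3 remains.\<close>

lemma theta_0_nonzero: "theta 0 \<noteq> 0"
proof -
  have r: "exp (- pi) \<le> 1 / 4"
  proof -
    have "exp pi \<ge> 4"
      using exp_ge_add_one_self[of pi] pi_gt3 by linarith
    then show ?thesis
      by (simp add: exp_minus field_simps)
  qed
  have "theta_series 1 = 1 + (\<Sum>n. theta_coeff (int (Suc n)))"
    unfolding theta_series_def
    using suminf_split_head[of "\<lambda>n. theta_coeff (int n) * 1 ^ n"] summable_norm_cancel[OF theta_series_abs_summable[of 1]]
    by simp
  moreover have "cmod (\<Sum>n. theta_coeff (int (Suc n))) \<le> 1 / 3"
  proof -
    have le: "cmod (theta_coeff (int (Suc n))) \<le> 1 / 4 * (1 / 4) ^ n" for n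
      using norm_theta_coeff_le[of "Suc n"] power_mono[OF r, of "Suc n"] by simp
    have s: "(\<lambda>n. 1 / 4 * (1 / 4 :: real) ^ n) sums (1 / 4 * (1 / (1 - 1 / 4)))"
      by (intro sums_mult geometric_sums) simp
    then show ?thesis
      using norm_suminf_le[OF le sums_summable[OF s]] unfolding sums_unique[OF s, symmetric] by simp
  qed
  ultimately show ?thesis
    using norm_triangle_ineq2[of "1::complex" "- 2 * (\<Sum>n. theta_coeff (int (Suc n)))"]
    by (auto simp: theta_def norm_mult)
qed

end

text \<open>The Gaussian factor compensates the exponential growth of the theta function in the
  direction of \<open>y\<close>.\<close>

lemma quasi_periodic_nontrivial:
  assumes tau: "Im \<tau> > 0"
  obtains f z where "f \<in> quasi_periodic \<tau> p" "f z \<noteq> 0"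
proof -
  \<comment> \<open>Chosen so that translating z by 1 moves \<open>L z\<close> by the integer p, and
    translating by tau moves it by p Re tau + i, the quasi-period of theta for this
    \<alpha>.\<close>
  define \<alpha> where "\<alpha> = of_int p * Re \<tau>"
  define L where "L z = of_int p * of_real (Re z) + \<i> * of_real (Im z / Im \<tau>)" for z :: complex
  define M where "M z = complex_of_real (Im z / Im \<tau>)" for z
  \<comment> \<open>The factors \<open>1\<close> match the form \<open>c * h (L z)\<close> of
    \<open>C_diff_holomorphic_comp\<close>.\<close>
  define f where "f z = 1 * exp (- of_real pi * (M z)\<^sup>2) * (1 * theta \<alpha> (L z))" for z
  have "bounded_linear (\<lambda>z. of_int p * of_real (Re z) + \<i> * of_real (1 / Im \<tau> * Im z))"
    by (intro bounded_linear_add bounded_linear_const_mult bounded_linear_compose[OF bounded_linear_of_real]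
        bounded_linear_Re bounded_linear_Im)
  then have L: "bounded_linear L"
    by (simp add: L_def[abs_def])
  have "bounded_linear (\<lambda>z. complex_of_real (1 / Im \<tau> * Im z))"
    by (intro bounded_linear_const_mult bounded_linear_compose[OF bounded_linear_of_real] bounded_linear_Im)
  then have M: "bounded_linear M"
    by (simp add: M_def[abs_def])
  have "C_diff k f" for k
    unfolding f_def
    by (intro C_diff_mult C_diff_holomorphic_comp[OF M, where h = "\<lambda>z. exp (- of_real pi * z\<^sup>2)"]
        C_diff_holomorphic_comp[OF L] theta_holomorphic holomorphic_intros)
  moreover have "f (z + 1) = f z" for z
  proof -
    have "L (z + 1) = L z + of_int p" "M (z + 1) = M z"
      by (simp_all add: L_def M_def algebra_simps)
    then show ?thesis
      by (simp add: f_def theta_plus_int)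
  qed
  moreover have "f (z + \<tau>) = automorphy \<tau> p z * f z" for z
  proof -
    have eq: "L (z + \<tau>) = L z + of_real \<alpha> + \<i>" "M (z + \<tau>) = M z + 1"
      using tau by (simp_all add: L_def M_def \<alpha>_def algebra_simps add_divide_distrib)
    have Lz: "L z = of_int p * of_real (Re z) + \<i> * M z"
      by (simp add: L_def M_def)
    \<comment> \<open>The Gaussian gains exp (-2 pi M - pi), which cancels the modulus of the theta
      factor; the remaining phase - pi i (\<alpha> + 2 p x) is the exponent of the automorphy
      factor.\<close>
    have "exp (- of_real pi * (M z + 1)\<^sup>2) * exp (- (of_real pi * \<i> * of_real \<alpha>) + of_real pi - 2 * of_real pi * \<i> * L z)
        = automorphy \<tau> p z * exp (- of_real pi * (M z)\<^sup>2)"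
      unfolding automorphy_def exp_add[symmetric] Lz \<alpha>_def
      by (rule arg_cong[of _ _ exp]) (simp add: algebra_simps power2_eq_square)
    then show ?thesis
      unfolding f_def eq theta_plus_period by (simp add: mult.assoc[symmetric])
  qed
  ultimately have "f \<in> quasi_periodic \<tau> p"
    by (simp add: quasi_periodic_iff smooth_fun_def)
  moreover have "f 0 \<noteq> 0"
    using theta_0_nonzero[of \<alpha>] by (simp add: f_def L_def)
  ultimately show ?thesis
    using that by blast
qed

section \<open>The equivalence\<close>

lemma exp_2pi_i_eq_1:
  assumes "exp (2 * of_real pi * \<i> * of_real r) = 1"
  shows "\<exists>k::int. r = of_int k"
proof -
  obtain k :: int where "Im (2 * of_real pi * \<i> * of_real r) = of_int (2 * k) * pi"
    using assms unfolding exp_eq_1 by blast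
  then have "r = of_int k"
    by simp
  then show ?thesis
    by blast
qed

text \<open>The value of the transformed function at z + tau is computed twice, from its own
  quasi-periodicity and from that of f. The results differ by the scalar, which must be 1 where the
  function is nonzero; z = w - s is such a point.\<close>

lemma exp_eq_1_if_phase_quasi_periodic:
  assumes f: "f \<in> quasi_periodic \<tau> p" "f w \<noteq> 0"
    and g: "(\<lambda>z. phase \<theta> (m, n) z * f (z + shift \<theta> (m, n))) \<in> quasi_periodic \<tau> p"
  shows "exp (2 * of_real pi * \<i> * of_real (of_int m * Re \<tau> + of_int n * (Im \<tau> - of_int p * \<theta> / 2))) = 1"
proof -
  define s where "s = shift \<theta> (m, n)"
  define z where "z = w - s"
  have "automorphy \<tau> p z * (phase \<theta> (m, n) z * f (z + s)) = phase \<theta> (m, n) (z + \<tau>) * f (z + \<tau> + s)"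
    using quasi_periodic_plus_tau[OF g, of z] by (simp add: s_def)
  also have "f (z + \<tau> + s) = automorphy \<tau> p (z + s) * f (z + s)"
    using quasi_periodic_plus_tau[OF f(1), of "z + s"] by (simp add: ac_simps)
  also have "phase \<theta> (m, n) (z + \<tau>) * (automorphy \<tau> p (z + s) * f (z + s))
      = automorphy \<tau> p z * (phase \<theta> (m, n) z * f (z + s)) *
        exp (2 * of_real pi * \<i> * of_real (of_int m * Re \<tau> + of_int n * (Im \<tau> - of_int p * \<theta> / 2)))"
    unfolding mult.assoc[symmetric] s_def phase_automorphy by (simp only: mult_ac)
  finally have "automorphy \<tau> p z * (phase \<theta> (m, n) z * f (z + s)) = automorphy \<tau> p z * (phase \<theta> (m, n) z * f (z + s)) *
        exp (2 * of_real pi * \<i> * of_real (of_int m * Re \<tau> + of_int n * (Im \<tau> - of_int p * \<theta> / 2)))" .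
  moreover have "automorphy \<tau> p z * (phase \<theta> (m, n) z * f (z + s)) \<noteq> 0"
    using f(2) norm_automorphy[of \<tau> p z] norm_phase[of \<theta> "(m, n)" z]
    by (auto simp: z_def simp del: norm_automorphy norm_phase)
  ultimately show ?thesis
    by (metis mult_cancel_left2)
qed

theorem proposition4p2:
  fixes \<theta> \<omega>\<^sub>x \<omega>\<^sub>y :: real and p :: int and \<tau> :: complex
    and A :: "'a cstar" and U V :: 'a
  assumes "0 \<le> \<theta>" and "\<theta> < 1"
    and "\<tau> = of_real \<omega>\<^sub>x + \<i> * of_real \<omega>\<^sub>y" and "\<omega>\<^sub>y > 0"
    and "universal_rotation_algebra \<theta> A U V"
  shows "right_submodule \<theta> A U V (quasi_periodic \<tau> p) \<longleftrightarrow>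
    \<tau> - of_real (of_int p * \<theta> / 2) * \<i> \<in> {of_int m + \<i> * of_int n | m n. True}"
proof
  have tau: "Re \<tau> = \<omega>\<^sub>x" "Im \<tau> = \<omega>\<^sub>y" "Im \<tau> > 0"
    using assms(3,4) by simp_all
  {
    assume sub: "right_submodule \<theta> A U V (quasi_periodic \<tau> p)"
    obtain f w where f: "f \<in> quasi_periodic \<tau> p" "f w \<noteq> 0"
      using quasi_periodic_nontrivial[OF tau(3)] by metis
    have single: "(\<Sum>\<^sub>\<infinity>r. (if r = q then 1 else 0) * h r) = h q" for q and h :: "int \<times> int \<Rightarrow> complex"
    proof -
      have "(\<Sum>\<^sub>\<infinity>r. (if r = q then 1 else 0) * h r) = (\<Sum>\<^sub>\<infinity>r\<in>{q}. (if r = q then 1 else 0) * h r)"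
        by (rule infsum_cong_neutral) auto
      then show ?thesis
        by simp
    qed
    have "nc_action \<theta> A U V f (monomial A U V q) = (\<lambda>z. phase \<theta> q z * f (z + shift \<theta> q))" for q
      unfolding nc_action_eq_twisted_series expansion_coeffs_monomial[OF assms(5)] twisted_series_def
      by (simp only: single)
    then have "(\<lambda>z. phase \<theta> q z * f (z + shift \<theta> q)) \<in> quasi_periodic \<tau> p" for q
      using sub f(1) monomial_in_smooth_algebra[OF assms(5)] unfolding right_submodule_def by metis
    from exp_eq_1_if_phase_quasi_periodic[OF f this] have
      "\<exists>k::int. of_int m * Re \<tau> + of_int n * (Im \<tau> - of_int p * \<theta> / 2) = of_int k" for m n
      by (rule exp_2pi_i_eq_1)
    from this[of 1 0] this[of 0 1] obtain k l :: int
      where "Re \<tau> = of_int k" "Im \<tau> - of_int p * \<theta> / 2 = of_int l"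
      by auto
    then have "\<tau> - of_real (of_int p * \<theta> / 2) * \<i> = of_int k + \<i> * of_int l"
      by (simp add: complex_eq_iff)
    then show "\<tau> - of_real (of_int p * \<theta> / 2) * \<i> \<in> {of_int m + \<i> * of_int n | m n. True}"
      by blast
  next
    assume "\<tau> - of_real (of_int p * \<theta> / 2) * \<i> \<in> {of_int m + \<i> * of_int n | m n. True}"
    then obtain k l :: int where "\<tau> - of_real (of_int p * \<theta> / 2) * \<i> = of_int k + \<i> * of_int l"
      by blast
    then have kl: "Re \<tau> = of_int k" "Im \<tau> - of_int p * \<theta> / 2 = of_int l"
      by (simp_all add: complex_eq_iff)
    have "nc_action \<theta> A U V f x \<in> quasi_periodic \<tau> p"
      if "f \<in> quasi_periodic \<tau> p" "x \<in> smooth_algebra A U V" for f x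
      unfolding nc_action_eq_twisted_series
      by (rule twisted_series_quasi_periodic[OF tau(3) that(1) expansion_coeffs_rapid[OF assms(5) that(2)] kl])
    moreover have "(\<lambda>z. 0) \<in> quasi_periodic \<tau> p"
      by (simp add: quasi_periodic_iff smooth_fun_def C_diff_const)
    moreover have "(\<lambda>z. f z + g z) \<in> quasi_periodic \<tau> p"
      if "f \<in> quasi_periodic \<tau> p" "g \<in> quasi_periodic \<tau> p" for f g
      using that by (simp add: quasi_periodic_iff smooth_fun_def C_diff_add distrib_left)
    moreover have "(\<lambda>z. c * f z) \<in> quasi_periodic \<tau> p" if "f \<in> quasi_periodic \<tau> p" for c f
      using that by (simp add: quasi_periodic_iff smooth_fun_def C_diff_mult C_diff_const)
    ultimately show "right_submodule \<theta> A U V (quasi_periodic \<tau> p)"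
      by (simp add: right_submodule_def)
  }
qed

end
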